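(* Let $m\in\mathbb{N}$, let $G$ be a finitely generated group with a homological connecting vector $(k_0,\ldots,k_m)$, and put $k:=\max(k_0,\ldots,k_m)$. If $\varphi_q:\mathrm{C}_q(\mathrm{VR}_k(G))\to\mathrm{C}_q(\mathrm{VR}_k(G))$, $q=0,\ldots,m$, is a chain endomorphism of $\mathbb{Z}G$-complexes extending the identity on $\mathbb{Z}$, then $U(\varphi)\subseteq\Sigma^m(G;\mathbb{Z})$.
   Context: A finitely generated group $G$ carries the word metric $d(g,h)=l(g^{-1}h)$ with respect to a finite generating set; subsets carry the subspace metric. For a metric space $X$, $k\ge 0$, $q\ge 0$, put $\Delta^q_k(X)=\{(x_0,\ldots,x_q)\in X^{q+1}\mid d(x_i,x_j)\le k \text{ for all } i,j\}$ and $\Delta^q_k=\Delta^q_k(G)$. The Vietoris--Rips complex $\mathrm{VR}_k(X)$ is the simplicial set with $q$-simplices $\Delta^q_k(X)$ (faces omit an entry, degeneracies repeat an entry). Its chain complex is $\mathrm{C}_q(\mathrm{VR}_k(X))=\mathbb{Z}[\Delta^q_k(X)]$ with $\partial_q(x_0,\ldots,x_q)=\sum_{i=0}^q(-1)^i(x_0,\ldots,\widehat{x_i},\ldots,x_q)$. For $X=G$ this is a complex of free $\mathbb{Z}G$-modules via diagonal left multiplication, with augmentation $\epsilon:\mathbb{Z}[G]\to\mathbb{Z}$, $g\mapsto1$; $\varphi$ extends the identity on $\mathbb{Z}$ if $\epsilon\circ\varphi_0=\epsilon$. For $i\le j$, $\tilde{\mathrm{H}}_q(\mathrm{VR}_i(X))$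 vanishes in $\tilde{\mathrm{H}}_q(\mathrm{VR}_j(X))$ if the inclusion-induced map is zero. $X$ is of type $\mathrm{FP}_m$ if for each $q=0,\ldots,m-1$ and every $i$ there is $j\ge i$ such that $\tilde{\mathrm{H}}_q(\mathrm{VR}_i(X))$ vanishes in $\tilde{\mathrm{H}}_q(\mathrm{VR}_j(X))$. A vector $(k_0,\ldots,k_m)$ is a homological connecting vector for $G$ if $\tilde{\mathrm{H}}_q(\mathrm{VR}_{k_q}(G))$ vanishes in $\tilde{\mathrm{H}}_q(\mathrm{VR}_{k_{q+1}}(G))$ for $q=0,\ldots,m-1$. A character is a homomorphism $\chi:G\to(\mathbb{R},+)$; $G_\chi=\{g\mid\chi(g)\ge0\}$; by definition $\chi\in\Sigma^m(G;\mathbb{Z})$ iff $(G_\chi,d)$ is of type $\mathrm{FP}_m$. For a chain $c$, $c^{(0)}\subseteq G$ is the set of vertices of simplices appearing in $c$ (a minimum over the empty set is $+\infty$). Define $u_\varphi:\mathrm{Hom}(G,\mathbb{R})\to\mathbb{R}$ by $$u_\varphi(\chi)=\min_{\substack{\bar x=(1_G,g_1,\ldots,g_q)\in\Delta^q_k\\ q=0,\ldots,m}}\Big(\min_{g\in\varphi_q(\bar x)^{(0)}}\chi(g)-\min_{g\in\bar x^{(0)}}\chi(g)\Big),$$ and $U(\varphi):=u_\varphi^{-1}((0,\infty))$. *)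

theory Defs
  imports "HOL-Algebra.Free_Abelian_Groups" "HOL-Algebra.Generated_Groups" "HOL-Library.Extended_Real"
begin

section \<open>Finitely generated groups and the word metric\<close>

definition finite_generating_set :: "('a, 'b) monoid_scheme \<Rightarrow> 'a set \<Rightarrow> bool"
  where "finite_generating_set G S \<longleftrightarrow>
    finite S \<and> S \<subseteq> carrier G \<and> generate G S = carrier G"

definition word_length :: "('a, 'b) monoid_scheme \<Rightarrow> 'a set \<Rightarrow> 'a \<Rightarrow> nat"
  where "word_length G S g =
    (LEAST n. \<exists>ws. length ws = n \<and> set ws \<subseteq> S \<union> (\<lambda>s. inv\<^bsub>G\<^esub> s) ` S
                    \<and> foldr (\<lambda>a b. a \<otimes>\<^bsub>G\<^esub> b) ws \<one>\<^bsub>G\<^esub> = g)"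

definition word_metric :: "('a, 'b) monoid_scheme \<Rightarrow> 'a set \<Rightarrow> 'a \<Rightarrow> 'a \<Rightarrow> real"
  where "word_metric G S g h = real (word_length G S (inv\<^bsub>G\<^esub> g \<otimes>\<^bsub>G\<^esub> h))"


section \<open>Vietoris--Rips complexes\<close>

text \<open>A metric space is given by a point set \<open>X\<close> and a distance function \<open>d\<close>; a subspace is
  the same \<open>d\<close> with a smaller \<open>X\<close>. A \<open>q\<close>-simplex is a list of length \<open>q + 1\<close>.\<close>

definition VR_simplices :: "('a \<Rightarrow> 'a \<Rightarrow> real) \<Rightarrow> 'a set \<Rightarrow> real \<Rightarrow> nat \<Rightarrow> 'a list set"
  where "VR_simplices d X k q =
    {x. length x = Suc q \<and> set x \<subseteq> X \<and> (\<forall>i\<le>q. \<forall>j\<le>q. d (x ! i) (x ! j) \<le> k)}"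

definition VR_chains :: "('a \<Rightarrow> 'a \<Rightarrow> real) \<Rightarrow> 'a set \<Rightarrow> real \<Rightarrow> nat \<Rightarrow> ('a list \<Rightarrow>\<^sub>0 int) monoid"
  where "VR_chains d X k q = free_Abelian_group (VR_simplices d X k q)"

definition VR_face :: "nat \<Rightarrow> 'a list \<Rightarrow> 'a list"
  where "VR_face i x = take i x @ drop (Suc i) x"

text \<open>Only meaningful for \<open>q \<ge> 1\<close>.\<close>

definition VR_boundary :: "nat \<Rightarrow> ('a list \<Rightarrow>\<^sub>0 int) \<Rightarrow> ('a list \<Rightarrow>\<^sub>0 int)"
  where "VR_boundary q =
    frag_extend (\<lambda>x. \<Sum>i\<in>{0..q}. frag_cmul ((-1) ^ i) (frag_of (VR_face i x)))"

definition augmentation :: "('a list \<Rightarrow>\<^sub>0 int) \<Rightarrow> int"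
  where "augmentation c = (\<Sum>x\<in>Poly_Mapping.keys c. Poly_Mapping.lookup c x)"

definition chain_vertices :: "('a list \<Rightarrow>\<^sub>0 int) \<Rightarrow> 'a set"
  where "chain_vertices c = (\<Union>x\<in>Poly_Mapping.keys c. set x)"


section \<open>Reduced homology, type FP, connecting vectors\<close>

definition VR_reduced_cycles ::
    "('a \<Rightarrow> 'a \<Rightarrow> real) \<Rightarrow> 'a set \<Rightarrow> real \<Rightarrow> nat \<Rightarrow> ('a list \<Rightarrow>\<^sub>0 int) monoid"
  where "VR_reduced_cycles d X k q = (VR_chains d X k q)
    \<lparr>carrier := {c \<in> carrier (VR_chains d X k q).
                  if q = 0 then augmentation c = 0 else VR_boundary q c = 0}\<rparr>"

definition VR_boundaries :: "('a \<Rightarrow> 'a \<Rightarrow> real) \<Rightarrow> 'a set \<Rightarrow> real \<Rightarrow> nat \<Rightarrow> ('a list \<Rightarrow>\<^sub>0 int) set"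
  where "VR_boundaries d X k q = VR_boundary (Suc q) ` carrier (VR_chains d X k (Suc q))"

definition VR_reduced_homology ::
    "('a \<Rightarrow> 'a \<Rightarrow> real) \<Rightarrow> 'a set \<Rightarrow> real \<Rightarrow> nat \<Rightarrow> ('a list \<Rightarrow>\<^sub>0 int) set monoid"
  where "VR_reduced_homology d X k q = VR_reduced_cycles d X k q Mod VR_boundaries d X k q"

text \<open>The map induced by the inclusion of the complex at scale \<open>i\<close> into the one at scale \<open>j\<close>,
  for \<open>i \<le> j\<close>: it sends the class \<open>C = B\<^sub>i + z\<close> to \<open>B\<^sub>j + C = B\<^sub>j + z\<close>. The scale \<open>i\<close> does
  not occur on the right-hand side because the chains at scale \<open>i\<close> are literally chains at
  scale \<open>j\<close>.\<close>

definition VR_inclusion_induced ::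
    "('a \<Rightarrow> 'a \<Rightarrow> real) \<Rightarrow> 'a set \<Rightarrow> real \<Rightarrow> nat \<Rightarrow> ('a list \<Rightarrow>\<^sub>0 int) set \<Rightarrow> ('a list \<Rightarrow>\<^sub>0 int) set"
  where "VR_inclusion_induced d X j q C =
    VR_boundaries d X j q <#>\<^bsub>VR_reduced_cycles d X j q\<^esub> C"

definition VR_homology_vanishes ::
    "('a \<Rightarrow> 'a \<Rightarrow> real) \<Rightarrow> 'a set \<Rightarrow> nat \<Rightarrow> real \<Rightarrow> real \<Rightarrow> bool"
  where "VR_homology_vanishes d X q i j \<longleftrightarrow>
    i \<le> j \<and> (\<forall>C\<in>carrier (VR_reduced_homology d X i q).
      VR_inclusion_induced d X j q C = \<one>\<^bsub>VR_reduced_homology d X j q\<^esub>)"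

definition type_FP :: "('a \<Rightarrow> 'a \<Rightarrow> real) \<Rightarrow> 'a set \<Rightarrow> nat \<Rightarrow> bool"
  where "type_FP d X m \<longleftrightarrow> (\<forall>q<m. \<forall>i\<ge>0. \<exists>j\<ge>i. VR_homology_vanishes d X q i j)"

definition homological_connecting_vector ::
    "('a, 'b) monoid_scheme \<Rightarrow> 'a set \<Rightarrow> nat \<Rightarrow> (nat \<Rightarrow> real) \<Rightarrow> bool"
  where "homological_connecting_vector G S m ks \<longleftrightarrow>
    (\<forall>q\<le>m. 0 \<le> ks q) \<and>
    (\<forall>q<m. VR_homology_vanishes (word_metric G S) (carrier G) q (ks q) (ks (Suc q)))"


section \<open>Characters and the homological Sigma-invariants\<close>

definition additive_real_group :: "real monoid"
  where "additive_real_group = \<lparr>carrier = UNIV, monoid.mult = (+), one = 0\<rparr>"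

definition characters :: "('a, 'b) monoid_scheme \<Rightarrow> ('a \<Rightarrow> real) set"
  where "characters G = hom G additive_real_group"

definition Sigma_inv :: "('a, 'b) monoid_scheme \<Rightarrow> 'a set \<Rightarrow> nat \<Rightarrow> ('a \<Rightarrow> real) set"
  where "Sigma_inv G S m =
    {\<chi> \<in> characters G. type_FP (word_metric G S) {g \<in> carrier G. 0 \<le> \<chi> g} m}"


section \<open>Chain endomorphisms over the integral group ring\<close>

text \<open>Elements of the group ring are the \<open>a\<close> with \<open>Poly_Mapping.keys a \<subseteq> carrier G\<close>; they act on
  chains by the bilinear extension of diagonal left multiplication.\<close>

definition group_ring_act ::
    "('a, 'b) monoid_scheme \<Rightarrow> ('a \<Rightarrow>\<^sub>0 int) \<Rightarrow> ('a list \<Rightarrow>\<^sub>0 int) \<Rightarrow> ('a list \<Rightarrow>\<^sub>0 int)"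
  where "group_ring_act G a c =
    frag_extend (\<lambda>g. frag_extend (\<lambda>x. frag_of (map (\<lambda>y. g \<otimes>\<^bsub>G\<^esub> y) x)) c) a"

definition group_ring_linear ::
    "('a, 'b) monoid_scheme \<Rightarrow> ('a list \<Rightarrow>\<^sub>0 int) monoid \<Rightarrow> ('a list \<Rightarrow>\<^sub>0 int) monoid
      \<Rightarrow> (('a list \<Rightarrow>\<^sub>0 int) \<Rightarrow> ('a list \<Rightarrow>\<^sub>0 int)) \<Rightarrow> bool"
  where "group_ring_linear G M N f \<longleftrightarrow>
    f \<in> hom M N \<and>
    (\<forall>a c. Poly_Mapping.keys a \<subseteq> carrier G \<longrightarrow> c \<in> carrier M \<longrightarrow>
      f (group_ring_act G a c) = group_ring_act G a (f c))"

definition VR_chain_endomorphism ::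
    "('a, 'b) monoid_scheme \<Rightarrow> 'a set \<Rightarrow> nat \<Rightarrow> real
      \<Rightarrow> (nat \<Rightarrow> ('a list \<Rightarrow>\<^sub>0 int) \<Rightarrow> ('a list \<Rightarrow>\<^sub>0 int)) \<Rightarrow> bool"
  where "VR_chain_endomorphism G S m k \<phi> \<longleftrightarrow>
    (let C = VR_chains (word_metric G S) (carrier G) k in
      (\<forall>q\<le>m. group_ring_linear G (C q) (C q) (\<phi> q)) \<and>
      (\<forall>q<m. \<forall>c\<in>carrier (C (Suc q)).
        VR_boundary (Suc q) (\<phi> (Suc q) c) = \<phi> q (VR_boundary (Suc q) c)))"

definition extends_identity ::
    "('a, 'b) monoid_scheme \<Rightarrow> 'a set \<Rightarrow> real
      \<Rightarrow> (nat \<Rightarrow> ('a list \<Rightarrow>\<^sub>0 int) \<Rightarrow> ('a list \<Rightarrow>\<^sub>0 int)) \<Rightarrow> bool"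
  where "extends_identity G S k \<phi> \<longleftrightarrow>
    (\<forall>c\<in>carrier (VR_chains (word_metric G S) (carrier G) k 0).
      augmentation (\<phi> 0 c) = augmentation c)"

text \<open>The minima are infima in the extended reals, which gives the convention that the minimum
  over the empty set is \<open>\<infinity>\<close>. All index sets are finite when \<open>S\<close> is a finite generating set, so
  nonempty infima are attained.\<close>

definition u_val ::
    "('a, 'b) monoid_scheme \<Rightarrow> 'a set \<Rightarrow> nat \<Rightarrow> real
      \<Rightarrow> (nat \<Rightarrow> ('a list \<Rightarrow>\<^sub>0 int) \<Rightarrow> ('a list \<Rightarrow>\<^sub>0 int)) \<Rightarrow> ('a \<Rightarrow> real) \<Rightarrow> ereal"
  where "u_val G S m k \<phi> \<chi> =
    (INF q\<in>{0..m}. INF x\<in>{x \<in> VR_simplices (word_metric G S) (carrier G) k q. x ! 0 = \<one>\<^bsub>G\<^esub>}.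
      (INF g\<in>chain_vertices (\<phi> q (frag_of x)). ereal (\<chi> g)) - (INF g\<in>set x. ereal (\<chi> g)))"

definition U_set ::
    "('a, 'b) monoid_scheme \<Rightarrow> 'a set \<Rightarrow> nat \<Rightarrow> real
      \<Rightarrow> (nat \<Rightarrow> ('a list \<Rightarrow>\<^sub>0 int) \<Rightarrow> ('a list \<Rightarrow>\<^sub>0 int)) \<Rightarrow> ('a \<Rightarrow> real) set"
  where "U_set G S m k \<phi> = {\<chi> \<in> characters G. u_val G S m k \<phi> \<chi> \<in> {0<..<\<infinity>}}"

end

theory Submission
  imports Defs
begin

text \<open>Let \<open>X\<close> be the half space \<open>\<chi> \<ge> 0\<close>. Since \<open>u\<^sub>\<phi>(\<chi>) > 0\<close> and \<open>\<phi>\<close> is equivariant, \<open>\<phi>\<close> raises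
  the \<open>\<chi>\<close>-minimum of every simplex by at least \<open>u > 0\<close>. The connecting vector gives an equivariant
  chain map \<open>\<alpha>\<close> from \<open>VR\<^sub>i(G)\<close> to \<open>VR\<^sub>k(G)\<close>; it lowers \<open>\<chi>\<close> by a bounded amount, so
  \<open>\<psi> = \<phi>\<^sup>s \<circ> \<alpha>\<close> maps \<open>X\<close> to \<open>X\<close> for some \<open>s\<close> depending on \<open>i\<close> only. Both \<open>\<psi>\<close> and \<open>\<phi>\<close> have bounded
  displacement, hence are homotopic to inclusions inside \<open>X\<close> at a uniform scale \<open>j\<close>. A cycle \<open>z\<close>
  of \<open>VR\<^sub>i(X)\<close> is therefore homologous in \<open>VR\<^sub>j(X)\<close> to \<open>\<phi>\<^sup>t(\<psi>(z))\<close> for every \<open>t\<close>. Fill \<open>\<alpha>(z)\<close> by some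
  \<open>w\<close> in \<open>VR\<^sub>k(G)\<close>: for large \<open>t\<close> the chain \<open>\<phi>\<^bsup>t+s\<^esup>(w)\<close> lies in \<open>X\<close> and bounds \<open>\<phi>\<^sup>t(\<psi>(z))\<close>.\<close>

section \<open>Extension by linearity\<close>

lemma frag_extend_frag_extend:
  "frag_extend f (frag_extend g c) = frag_extend (\<lambda>x. frag_extend f (g x)) c"
  using subset_UNIV
  by (induction c rule: frag_induction) (auto simp: frag_extend_diff)

lemma frag_extend_diff_fun:
  "frag_extend (\<lambda>x. f x - g x) c = frag_extend f c - frag_extend g c"
  using subset_UNIV
  by (induction c rule: frag_induction) (auto simp: frag_extend_diff)

text \<open>A homomorphism out of a free abelian group is determined by the generators. This brings
  the maps \<open>\<phi> q\<close>, given as abstract homomorphisms, into the form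
  \<open>frag_extend\<close>; the condition on \<open>keys c\<close> is there because
  \<open>f\<close> is arbitrary off the carrier.\<close>

lemma hom_frag_eq_extend:
  assumes "f \<in> hom (free_Abelian_group S) (free_Abelian_group T)" "Poly_Mapping.keys c \<subseteq> S"
  shows "f c = frag_extend (\<lambda>x. f (frag_of x)) c"
proof (rule free_Abelian_group_induct[OF assms(2)])
  have "f (0 - 0) = f 0 - f 0"
    using assms(1) by (rule hom_frag_diff) auto
  then show "f 0 = frag_extend (\<lambda>x. f (frag_of x)) 0" by simp
qed (auto simp: frag_extend_diff hom_frag_diff[OF assms(1)])

section \<open>The augmented boundary operator on lists\<close>

abbreviation cone :: "'a \<Rightarrow> ('a list \<Rightarrow>\<^sub>0 int) \<Rightarrow> ('a list \<Rightarrow>\<^sub>0 int)"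
  where "cone a \<equiv> frag_extend (\<lambda>x. frag_of (a # x))"

text \<open>The empty list plays the role of the simplex of degree \<open>-1\<close>, so that reduced cycles of
  every degree are the chains with vanishing boundary.\<close>

primrec list_bd :: "'a list \<Rightarrow> ('a list \<Rightarrow>\<^sub>0 int)"
  where
    "list_bd [] = 0"
  | "list_bd (a # x) = frag_of x - cone a (list_bd x)"

abbreviation bd :: "('a list \<Rightarrow>\<^sub>0 int) \<Rightarrow> ('a list \<Rightarrow>\<^sub>0 int)"
  where "bd \<equiv> frag_extend list_bd"

text \<open>The contraction of the complex of all lists: a cycle \<open>c\<close> is the boundary of
  \<open>cone a c\<close>. The empty list makes this hold in the lowest degree as well.\<close>

lemma bd_cone: "bd (cone a c) = c - cone a (bd c)"
  using subset_UNIV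
  by (induction c rule: frag_induction) (auto simp: frag_extend_diff)

lemma bd_list_bd: "bd (list_bd x) = 0"
  by (induction x) (auto simp: frag_extend_diff bd_cone)

lemma keys_cone: "Poly_Mapping.keys (cone a c) \<subseteq> (#) a ` Poly_Mapping.keys c"
  using keys_frag_extend[of "\<lambda>x. frag_of (a # x)" c] by auto

lemma keys_list_bd:
  "y \<in> Poly_Mapping.keys (list_bd x) \<Longrightarrow> length x = Suc (length y) \<and> set y \<subseteq> set x"
proof (induction x arbitrary: y)
  case (Cons a x)
  have "y = x \<or> y \<in> (#) a ` Poly_Mapping.keys (list_bd x)"
    using Cons.prems keys_diff[of "frag_of x" "cone a (list_bd x)"] keys_cone[of a "list_bd x"]
    by auto
  then show ?case
    using Cons.IH by fastforce
qed simp

text \<open>Deleting entry \<open>Suc i\<close> of \<open>a # x\<close> amounts to putting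
  \<open>a\<close> in front of the deletion of entry \<open>i\<close> of \<open>x\<close>; the sign
  change is the minus before the cone in \<open>list_bd\<close>.\<close>

lemma list_bd_eq_sum_faces:
  "list_bd x = (\<Sum>i<length x. frag_cmul ((-1) ^ i) (frag_of (VR_face i x)))"
proof (induction x)
  case (Cons a x)
  have "cone a (list_bd x) = (\<Sum>i<length x. frag_cmul ((-1) ^ i) (frag_of (a # VR_face i x)))"
    by (simp add: Cons frag_extend_sum frag_extend_cmul o_def)
  moreover have "frag_cmul ((-1) ^ Suc i) (frag_of (VR_face (Suc i) (a # x)))
      = - frag_cmul ((-1) ^ i) (frag_of (a # VR_face i x))" for i
    by (simp add: VR_face_def)
  ultimately show ?case
    by (simp only: length_Cons sum.lessThan_Suc_shift sum_negf list_bd.simps)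
      (simp add: VR_face_def)
qed simp

lemma VR_boundary_eq_bd:
  assumes "Poly_Mapping.keys c \<subseteq> {x. length x = Suc q}"
  shows "VR_boundary q c = bd c"
  unfolding VR_boundary_def
proof (rule frag_extend_eq)
  fix x assume "x \<in> Poly_Mapping.keys c"
  then have "{0..q} = {..<length x}" using assms by auto
  then show "(\<Sum>i = 0..q. frag_cmul ((- 1) ^ i) (frag_of (VR_face i x))) = list_bd x"
    by (simp add: list_bd_eq_sum_faces)
qed

text \<open>Each one-element list has the empty list as its boundary, so \<open>bd\<close> counts
  coefficients. The augmentation thus becomes one more boundary map, and degree 0 rarely needs
  separate treatment below.\<close>

lemma bd_eq_augmentation:
  assumes "Poly_Mapping.keys c \<subseteq> {x. length x = Suc 0}"
  shows "bd c = frag_cmul (augmentation c) (frag_of [])"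
proof -
  have "bd c = frag_extend (\<lambda>_. frag_of []) c"
  proof (rule frag_extend_eq)
    fix x assume "x \<in> Poly_Mapping.keys c"
    then obtain a where "x = [a]" using assms by (auto simp: length_Suc_conv)
    then show "list_bd x = frag_of []" by simp
  qed
  also have "\<dots> = frag_cmul (augmentation c) (frag_of [])"
  proof -
    have sum: "frag_cmul (sum f I) b = (\<Sum>i\<in>I. frag_cmul (f i) b)" if "finite I" 
      for f and I :: "'c set" and b :: "'b \<Rightarrow>\<^sub>0 int"
      using that by (induction I) (auto simp: frag_cmul_distrib)
    show ?thesis by (simp add: frag_extend_def augmentation_def sum)
  qed
  finally show ?thesis .
qed

section \<open>Rips complexes as sets of lists\<close>

text \<open>Simplices of all degrees form one set, with the empty list in degree -1. Bounding
  distances between vertices instead of positions makes closure under faces, reorderings and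
  repetitions immediate.\<close>

definition rips :: "('a \<Rightarrow> 'a \<Rightarrow> real) \<Rightarrow> 'a set \<Rightarrow> real \<Rightarrow> 'a list set"
  where "rips d X k = {x. set x \<subseteq> X \<and> (\<forall>u\<in>set x. \<forall>v\<in>set x. d u v \<le> k)}"

text \<open>The index is the list length: \<open>n = Suc q\<close> is degree
  \<open>q\<close>.\<close>

definition rips_chains :: "('a \<Rightarrow> 'a \<Rightarrow> real) \<Rightarrow> 'a set \<Rightarrow> real \<Rightarrow> nat \<Rightarrow> ('a list \<Rightarrow>\<^sub>0 int) set"
  where "rips_chains d X k n = {c. Poly_Mapping.keys c \<subseteq> {x \<in> rips d X k. length x = n}}"

lemma VR_simplices_eq_rips: "VR_simplices d X k q = {x \<in> rips d X k. length x = Suc q}"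
  by (fastforce simp: VR_simplices_def rips_def in_set_conv_nth less_Suc_eq_le)

lemma carrier_VR_chains: "carrier (VR_chains d X k q) = rips_chains d X k (Suc q)"
  by (auto simp: VR_chains_def rips_chains_def VR_simplices_eq_rips)

lemma rips_mono: "k \<le> k' \<Longrightarrow> X \<subseteq> Y \<Longrightarrow> rips d X k \<subseteq> rips d Y k'"
  by (force simp: rips_def)

lemma rips_chains_mono: "k \<le> k' \<Longrightarrow> X \<subseteq> Y \<Longrightarrow> rips_chains d X k n \<subseteq> rips_chains d Y k' n"
  using rips_mono[of k k' X Y d] by (fastforce simp: rips_chains_def)

lemma rips_subset: "x \<in> rips d X k \<Longrightarrow> set y \<subseteq> set x \<Longrightarrow> y \<in> rips d X k"
  by (auto simp: rips_def)

lemma list_bd_rips_chains: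
  "x \<in> rips d X k \<Longrightarrow> length x = Suc n \<Longrightarrow> list_bd x \<in> rips_chains d X k n"
  using keys_list_bd rips_subset by (fastforce simp: rips_chains_def)

lemma frag_extend_rips_chains:
  assumes "c \<in> rips_chains d X k n"
    and "\<And>x. x \<in> rips d X k \<Longrightarrow> length x = n \<Longrightarrow> f x \<in> rips_chains d Y l p"
  shows "frag_extend f c \<in> rips_chains d Y l p"
  using assms keys_frag_extend[of f c] by (fastforce simp: rips_chains_def)

lemma rips_chains_add: "c \<in> rips_chains d X k n \<Longrightarrow> e \<in> rips_chains d X k n \<Longrightarrow> c + e \<in> rips_chains d X k n"
  using Poly_Mapping.keys_add[of c e] by (auto simp: rips_chains_def)

lemma rips_chains_diff: "c \<in> rips_chains d X k n \<Longrightarrow> e \<in> rips_chains d X k n \<Longrightarrow> c - e \<in> rips_chains d X k n"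
  using keys_diff[of c e] by (auto simp: rips_chains_def)

lemma rips_chains_0: "0 \<in> rips_chains d X k n"
  by (simp add: rips_chains_def)

lemma frag_of_rips_chains:
  "frag_of x \<in> rips_chains d X k n \<longleftrightarrow> x \<in> rips d X k \<and> length x = n"
  by (simp add: rips_chains_def)

lemma bd_rips_chains: "c \<in> rips_chains d X k (Suc n) \<Longrightarrow> bd c \<in> rips_chains d X k n"
  by (erule frag_extend_rips_chains) (rule list_bd_rips_chains)

section \<open>Vanishing of homology in terms of cycles and boundaries\<close>

lemma VR_boundaries_eq: "VR_boundaries d X k q = bd ` rips_chains d X k (Suc (Suc q))"
  unfolding VR_boundaries_def carrier_VR_chains
  by (intro image_cong refl VR_boundary_eq_bd) (auto simp: rips_chains_def)

lemma carrier_VR_reduced_cycles: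
  "carrier (VR_reduced_cycles d X k q) = {c \<in> rips_chains d X k (Suc q). bd c = 0}"
proof -
  have "(if q = 0 then augmentation c = 0 else VR_boundary q c = 0) \<longleftrightarrow> bd c = 0"
    if "c \<in> rips_chains d X k (Suc q)" for c
  proof (cases "q = 0")
    case True
    then have "bd c = frag_cmul (augmentation c) (frag_of [])"
      using that by (intro bd_eq_augmentation) (auto simp: rips_chains_def)
    then show ?thesis using True by simp
  next
    case False
    have "VR_boundary q c = bd c"
      using that by (intro VR_boundary_eq_bd) (auto simp: rips_chains_def)
    then show ?thesis using False by simp
  qed
  then have "{c \<in> rips_chains d X k (Suc q). if q = 0 then augmentation c = 0 else VR_boundary q c = 0}
      = {c \<in> rips_chains d X k (Suc q). bd c = 0}"
    by (intro Collect_cong conj_cong refl)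
  then show ?thesis
    by (simp add: VR_reduced_cycles_def carrier_VR_chains)
qed

text \<open>Removes the quotient groups: all later arguments about homology only ask whether a cycle
  at one scale bounds at a larger one.\<close>

lemma VR_homology_vanishes_iff:
  "VR_homology_vanishes d X q i j \<longleftrightarrow> i \<le> j \<and>
    (\<forall>z\<in>rips_chains d X i (Suc q). bd z = 0 \<longrightarrow> z \<in> bd ` rips_chains d X j (Suc (Suc q)))"
proof -
  define B where "B k = bd ` rips_chains d X k (Suc (Suc q))" for k
  have mult: "x \<otimes>\<^bsub>VR_reduced_cycles d X j q\<^esub> y = x + y" for x y j
    by (simp add: VR_reduced_cycles_def VR_chains_def)
  have B0: "0 \<in> B k" for k
    unfolding B_def using rips_chains_0[of d X k] by (intro image_eqI[of 0 _ 0]) auto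
  have Badd: "x + y \<in> B k" if "x \<in> B k" "y \<in> B k" for x y k
    using that by (auto simp: B_def rips_chains_add simp flip: frag_extend_add)
  have Bdiff: "x - y \<in> B k" if "x \<in> B k" "y \<in> B k" for x y k
    using that by (auto simp: B_def rips_chains_diff simp flip: frag_extend_diff)
  have Bmono: "B i \<subseteq> B j" if "i \<le> j"
    unfolding B_def using rips_chains_mono[OF that subset_refl] by blast
  \<comment> \<open>The class of \<open>z\<close> is sent to \<open>B j + B i + z\<close>. Since
    \<open>B i \<subseteq> B j\<close> and \<open>B j\<close> is closed under sums and differences,
    this is \<open>B j\<close> exactly when \<open>z\<close> lies in \<open>B j\<close>.\<close>
  have ind: "VR_inclusion_induced d X j q (B i #>\<^bsub>VR_reduced_cycles d X i q\<^esub> z) = B j \<longleftrightarrow> z \<in> B j"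
    if "i \<le> j" for z
  proof -
    have eq: "VR_inclusion_induced d X j q (B i #>\<^bsub>VR_reduced_cycles d X i q\<^esub> z)
        = {b + (b' + z) | b b'. b \<in> B j \<and> b' \<in> B i}"
      unfolding VR_inclusion_induced_def VR_boundaries_eq
      by (auto simp: set_mult_def r_coset_def mult B_def)
    show ?thesis
    proof
      assume "VR_inclusion_induced d X j q (B i #>\<^bsub>VR_reduced_cycles d X i q\<^esub> z) = B j"
      moreover have "z = 0 + (0 + z)" by simp
      ultimately show "z \<in> B j" unfolding eq using B0 by blast
    next
      assume z: "z \<in> B j"
      have "b \<in> {b + (b' + z) | b b'. b \<in> B j \<and> b' \<in> B i}" if "b \<in> B j" for b
      proof -
        have "b = (b - z) + (0 + z)" by simp
        then show ?thesis using Bdiff[OF that z] B0 by blast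
      qed
      moreover have "b + (b' + z) \<in> B j" if "b \<in> B j" "b' \<in> B i" for b b'
        using that Bmono[OF \<open>i \<le> j\<close>] z Badd by blast
      ultimately show "VR_inclusion_induced d X j q (B i #>\<^bsub>VR_reduced_cycles d X i q\<^esub> z) = B j"
        unfolding eq by blast
    qed
  qed
  have car: "carrier (VR_reduced_homology d X i q)
      = (\<lambda>z. B i #>\<^bsub>VR_reduced_cycles d X i q\<^esub> z) ` {c \<in> rips_chains d X i (Suc q). bd c = 0}"
    by (auto simp: VR_reduced_homology_def FactGroup_def RCOSETS_def carrier_VR_reduced_cycles
        VR_boundaries_eq B_def)
  have one: "\<one>\<^bsub>VR_reduced_homology d X j q\<^esub> = B j"
    by (simp add: VR_reduced_homology_def FactGroup_def VR_boundaries_eq B_def)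
  show ?thesis
    by (simp add: VR_homology_vanishes_def car one ind flip: B_def cong: conj_cong) blast
qed

section \<open>Chain maps and the cone homotopy\<close>

text \<open>The condition on the empty list says that the chain map commutes with the augmentation.\<close>

definition chain_map_on :: "'a list set \<Rightarrow> 'a list set \<Rightarrow> nat \<Rightarrow> ('a list \<Rightarrow> ('a list \<Rightarrow>\<^sub>0 int)) \<Rightarrow> bool"
  where "chain_map_on K L N F \<longleftrightarrow> F [] = frag_of [] \<and>
    (\<forall>x\<in>K. length x \<le> N \<longrightarrow>
      Poly_Mapping.keys (F x) \<subseteq> {y \<in> L. length y = length x} \<and>
      bd (F x) = frag_extend F (list_bd x))"

lemma chain_map_on_keys:
  assumes "chain_map_on K L N F" "x \<in> K" "length x \<le> N" "y \<in> Poly_Mapping.keys (F x)"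
  shows "y \<in> L" "length y = length x"
  using assms unfolding chain_map_on_def by blast+

lemma chain_map_on_bd:
  assumes "chain_map_on K L N F" "Poly_Mapping.keys c \<subseteq> {x \<in> K. length x \<le> N}"
  shows "bd (frag_extend F c) = frag_extend F (bd c)"
  unfolding frag_extend_frag_extend
  using assms by (intro frag_extend_eq) (auto simp: chain_map_on_def)

lemma chain_map_on_rips_chains:
  assumes "chain_map_on (rips d X k) (rips d Y l) N F" "c \<in> rips_chains d X k n" "n \<le> N"
  shows "frag_extend F c \<in> rips_chains d Y l n" "bd (frag_extend F c) = frag_extend F (bd c)"
proof -
  show "frag_extend F c \<in> rips_chains d Y l n"
    using assms(2)
    by (rule frag_extend_rips_chains)
      (use assms(1,3) in \<open>auto simp: rips_chains_def chain_map_on_def\<close>)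
  show "bd (frag_extend F c) = frag_extend F (bd c)"
    by (rule chain_map_on_bd[OF assms(1)]) (use assms(2,3) in \<open>auto simp: rips_chains_def\<close>)
qed

text \<open>A bound for the vertices of the homotopy on \<open>x\<close>. Admitting all lists over
  \<open>set x\<close> that are no longer than \<open>x\<close>, and not just iterated faces, makes
  it monotone at once.\<close>

definition reach :: "('a list \<Rightarrow> ('a list \<Rightarrow>\<^sub>0 int)) \<Rightarrow> 'a list \<Rightarrow> 'a set"
  where "reach F x = set x \<union> (\<Union>y\<in>{y. set y \<subseteq> set x \<and> length y \<le> length x}. chain_vertices (F y))"

lemma reach_mono: "set y \<subseteq> set x \<Longrightarrow> length y \<le> length x \<Longrightarrow> reach F y \<subseteq> reach F x"
  unfolding reach_def by (intro Un_mono UN_mono) auto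

text \<open>The cone over \<open>x\<close> has its apex at the first vertex of \<open>x\<close>, so the homotopy needs no vertices
  besides those of \<open>x\<close> and of the images of its faces. This keeps it inside any subspace
  that \<open>F\<close> preserves.\<close>

lemma chain_homotopy_exists:
  assumes K: "\<And>x y. x \<in> K \<Longrightarrow> set y \<subseteq> set x \<Longrightarrow> y \<in> K"
    and F: "chain_map_on K L N F"
  shows "\<exists>h. \<forall>x\<in>K. length x \<le> N \<longrightarrow>
    bd (h x) = F x - frag_of x - frag_extend h (list_bd x) \<and>
    Poly_Mapping.keys (h x) \<subseteq> {w. length w = Suc (length x) \<and> set w \<subseteq> reach F x}"
  using F
proof (induction N)
  case 0
  \<comment> \<open>Only the empty list occurs, and \<open>F [] - frag_of []\<close> is zero, so the
    zero homotopy serves.\<close>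
  then show ?case by (intro exI[of _ "\<lambda>_. 0"]) (auto simp: chain_map_on_def)
next
  case (Suc N)
  have "chain_map_on K L N F" using Suc.prems by (auto simp: chain_map_on_def)
  from Suc.IH[OF this] obtain h where
    h_bd: "\<And>x. x \<in> K \<Longrightarrow> length x \<le> N \<Longrightarrow> bd (h x) = F x - frag_of x - frag_extend h (list_bd x)"
    and h_keys: "\<And>x w. x \<in> K \<Longrightarrow> length x \<le> N \<Longrightarrow> w \<in> Poly_Mapping.keys (h x)
      \<Longrightarrow> length w = Suc (length x) \<and> set w \<subseteq> reach F x"
    by blast
  \<comment> \<open>The boundary that the homotopy identity prescribes for \<open>h x\<close>. By
    the identity on the faces and \<open>bd_list_bd\<close> it is a cycle, so a cone over it fills
    it.\<close>
  define c where "c x = F x - frag_of x - frag_extend h (list_bd x)" for x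
  define h' where "h' x = (if length x = Suc N then cone (hd x) (c x) else h x)" for x
  have faces: "y \<in> K" "length y = N" if "x \<in> K" "length x = Suc N" "y \<in> Poly_Mapping.keys (list_bd x)" for x y
    using that K keys_list_bd by fastforce+
  have ext_h': "frag_extend h' (list_bd x) = frag_extend h (list_bd x)" if "length x \<le> Suc N" for x
    by (rule frag_extend_eq) (use that in \<open>auto dest!: keys_list_bd simp: h'_def\<close>)
  have bd_c: "bd (c x) = 0" if x: "x \<in> K" "length x = Suc N" for x
  proof -
    have "bd (frag_extend h (list_bd x))
        = frag_extend (\<lambda>y. F y - frag_of y - frag_extend h (list_bd y)) (list_bd x)"
      unfolding frag_extend_frag_extend
      by (rule frag_extend_eq) (use faces[OF x] in \<open>auto intro!: h_bd\<close>)
    also have "\<dots> = frag_extend F (list_bd x) - list_bd x - frag_extend h (bd (list_bd x))"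
      by (simp add: frag_extend_diff_fun frag_extend_frag_extend flip: frag_expansion)
    finally show ?thesis
      using Suc.prems x by (simp add: c_def frag_extend_diff chain_map_on_def bd_list_bd)
  qed
  have bd_h': "bd (h' x) = c x" if "x \<in> K" "length x = Suc N" for x
    using that by (simp add: h'_def bd_cone bd_c)
  have keys_h': "length w = Suc (Suc N) \<and> set w \<subseteq> reach F x"
    if x: "x \<in> K" "length x = Suc N" and w: "w \<in> Poly_Mapping.keys (h' x)" for x w
  proof -
    obtain y where y: "y \<in> Poly_Mapping.keys (c x)" "w = hd x # y"
      using w keys_cone x by (fastforce simp: h'_def)
    have "hd x \<in> reach F x" using x by (cases x) (auto simp: reach_def)
    have "y \<in> Poly_Mapping.keys (F x) \<or> y = x \<or> y \<in> Poly_Mapping.keys (frag_extend h (list_bd x))"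
      using y(1) keys_diff[of "F x - frag_of x" "frag_extend h (list_bd x)"] keys_diff[of "F x" "frag_of x"]
      by (auto simp: c_def)
    then have "length y = Suc N \<and> set y \<subseteq> reach F x"
    proof (elim disjE)
      assume y: "y \<in> Poly_Mapping.keys (F x)"
      then show ?thesis
        using chain_map_on_keys(2)[OF Suc.prems x(1) _ y] x
        by (auto simp: reach_def chain_vertices_def)
    next
      assume "y = x" then show ?thesis using x by (auto simp: reach_def)
    next
      assume "y \<in> Poly_Mapping.keys (frag_extend h (list_bd x))"
      then obtain f where f: "f \<in> Poly_Mapping.keys (list_bd x)" "y \<in> Poly_Mapping.keys (h f)"
        using keys_frag_extend[of h "list_bd x"] by blast
      have "reach F f \<subseteq> reach F x"
        using keys_list_bd[OF f(1)] by (intro reach_mono) auto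
      with h_keys[of f y] faces[OF x f(1)] f(2) show ?thesis by auto
    qed
    with y \<open>hd x \<in> reach F x\<close> show ?thesis by auto
  qed
  have h'_eq: "h' x = h x" if "length x \<le> N" for x using that by (simp add: h'_def)
  show ?case
  proof (intro exI[of _ h'] ballI impI conjI)
    fix x assume x: "x \<in> K" "length x \<le> Suc N"
    show "bd (h' x) = F x - frag_of x - frag_extend h' (list_bd x)"
      unfolding ext_h'[OF x(2)]
      using bd_h'[OF x(1)] h_bd[OF x(1)] h'_eq[of x] x(2) by (cases "length x = Suc N") (auto simp: c_def)
    show "Poly_Mapping.keys (h' x) \<subseteq> {w. length w = Suc (length x) \<and> set w \<subseteq> reach F x}"
    proof (cases "length x = Suc N")
      case True
      then show ?thesis using keys_h'[OF x(1)] by auto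
    next
      case False
      then have "length x \<le> N" using x by simp
      with h_keys[OF x(1) this] h'_eq show ?thesis by auto
    qed
  qed
qed

text \<open>Each vertex of the homotopy on \<open>x\<close> is within \<open>E\<close> of a vertex
  of \<open>x\<close>, and those are at most \<open>i\<close> apart; hence the scale
  \<open>i + 2 * E\<close>. As \<open>d\<close> is not assumed symmetric, \<open>near\<close> bounds
  both directions. On a cycle the term \<open>frag_extend h (bd z)\<close> disappears.\<close>

lemma chain_map_homotopic_id:
  assumes triangle: "\<And>a b c. a \<in> X \<Longrightarrow> b \<in> X \<Longrightarrow> c \<in> X \<Longrightarrow> d a c \<le> d a b + d b c"
    and F: "chain_map_on (rips d X i) (rips d X k) N F"
    and near: "\<And>x v. x \<in> rips d X i \<Longrightarrow> length x \<le> N \<Longrightarrow> x \<noteq> [] \<Longrightarrow> v \<in> chain_vertices (F x)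
      \<Longrightarrow> d (hd x) v \<le> E \<and> d v (hd x) \<le> E"
    and "0 \<le> E"
    and z: "z \<in> rips_chains d X i n" "n \<le> N" "bd z = 0"
  shows "frag_extend F z - z \<in> bd ` rips_chains d X (i + 2 * E) (Suc n)"
proof -
  have "\<exists>h. \<forall>x\<in>rips d X i. length x \<le> N \<longrightarrow>
      bd (h x) = F x - frag_of x - frag_extend h (list_bd x) \<and>
      Poly_Mapping.keys (h x) \<subseteq> {w. length w = Suc (length x) \<and> set w \<subseteq> reach F x}"
    by (rule chain_homotopy_exists[OF _ F]) (rule rips_subset)
  then obtain h where h: "\<forall>x\<in>rips d X i. length x \<le> N \<longrightarrow>
      bd (h x) = F x - frag_of x - frag_extend h (list_bd x) \<and>
      Poly_Mapping.keys (h x) \<subseteq> {w. length w = Suc (length x) \<and> set w \<subseteq> reach F x}" ..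
  have h_bd: "bd (h x) = F x - frag_of x - frag_extend h (list_bd x)"
    if "x \<in> rips d X i" "length x \<le> N" for x
    using h that by blast
  have h_keys: "length w = Suc (length x) \<and> set w \<subseteq> reach F x"
    if "x \<in> rips d X i" "length x \<le> N" "w \<in> Poly_Mapping.keys (h x)" for x w
    using h that by blast
  have reach: "\<exists>y\<in>set x. d y v \<le> E \<and> d v y \<le> E \<or> v = y" "v \<in> X"
    if x: "x \<in> rips d X i" "length x \<le> N" and v: "v \<in> reach F x" for x v
  proof -
    have *: "v \<in> X \<and> (\<exists>y\<in>set x. d y v \<le> E \<and> d v y \<le> E \<or> v = y)"
    proof (cases "v \<in> set x")
      case True
      then show ?thesis using x by (auto simp: rips_def)
    next
      case False
      then obtain y where y: "set y \<subseteq> set x" "length y \<le> length x" "v \<in> chain_vertices (F y)"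
        using v by (auto simp: reach_def)
      have yr: "y \<in> rips d X i" using x y rips_subset by blast
      \<comment> \<open>\<open>F []\<close> has no vertices, so the list that contributes
        \<open>v\<close> is nonempty and \<open>near\<close> applies to its head, which is a vertex
        of \<open>x\<close>.\<close>
      have "y \<noteq> []"
        using y(3) F by (auto simp: chain_map_on_def chain_vertices_def)
      moreover have "v \<in> X"
        using y(3) chain_map_on_keys[OF F yr] y(2) x(2)
        by (auto simp: chain_vertices_def rips_def)
      ultimately show ?thesis
        using near[OF yr _ _ y(3)] y x by (metis hd_in_set le_trans subsetD)
    qed
    from * show "\<exists>y\<in>set x. d y v \<le> E \<and> d v y \<le> E \<or> v = y" "v \<in> X" by auto
  qed
  have "h x \<in> rips_chains d X (i + 2 * E) (Suc n)" if x: "x \<in> rips d X i" "length x = n" for x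
  proof -
    have "d u v \<le> i + 2 * E" if u: "u \<in> reach F x" and v: "v \<in> reach F x" for u v
    proof -
      have xN: "length x \<le> N" using x z by simp
      obtain a where a: "a \<in> set x" "d u a \<le> E \<or> u = a" using reach(1)[OF x(1) xN u] by blast
      obtain b where b: "b \<in> set x" "d b v \<le> E \<or> v = b" using reach(1)[OF x(1) xN v] by blast
      have X: "a \<in> X" "b \<in> X" "u \<in> X" "v \<in> X"
        using a b x u v reach(2)[OF x(1) xN] by (auto simp: rips_def)
      have "d a b \<le> i" using a b x by (auto simp: rips_def)
      moreover have "d u b \<le> E + d a b"
        using a(2) triangle[of u a b] X \<open>0 \<le> E\<close> by auto
      moreover have "d u v \<le> d u b + E"
        using b(2) triangle[of u b v] X \<open>0 \<le> E\<close> by auto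
      ultimately show ?thesis by simp
    qed
    moreover have "length x \<le> N"
      using x z(2) by simp
    with reach(2)[OF x(1)] have "reach F x \<subseteq> X"
      by (auto simp only:)
    ultimately have "w \<in> rips d X (i + 2 * E)" if "set w \<subseteq> reach F x" for w
      unfolding rips_def using that by (simp add: subset_iff)
    with h_keys[OF x(1) \<open>length x \<le> N\<close>] x(2) have "w \<in> rips d X (i + 2 * E) \<and> length w = Suc n"
      if "w \<in> Poly_Mapping.keys (h x)" for w
      using that by simp
    then show ?thesis
      by (auto simp: rips_chains_def)
  qed
  then have "frag_extend h z \<in> rips_chains d X (i + 2 * E) (Suc n)"
    using z(1) by (rule frag_extend_rips_chains[rotated])
  moreover have "bd (frag_extend h z) = frag_extend F z - z"
  proof -
    have "bd (frag_extend h z) = frag_extend (\<lambda>x. F x - frag_of x - frag_extend h (list_bd x)) z"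
      unfolding frag_extend_frag_extend
      using z by (intro frag_extend_eq h_bd) (auto simp: rips_chains_def)
    also have "\<dots> = frag_extend F z - z - frag_extend h (bd z)"
      by (simp add: frag_extend_diff_fun frag_extend_frag_extend flip: frag_expansion)
    finally show ?thesis using z by simp
  qed
  ultimately show ?thesis by (metis image_eqI)
qed

section \<open>Vertices of chains and restriction to subspaces\<close>

lemma chain_vertices_rips_chains: "c \<in> rips_chains d X k n \<Longrightarrow> chain_vertices c \<subseteq> X"
  by (auto simp: chain_vertices_def rips_chains_def rips_def)

lemma chain_vertices_frag_extend:
  "chain_vertices (frag_extend f c) \<subseteq> (\<Union>x\<in>Poly_Mapping.keys c. chain_vertices (f x))"
  using keys_frag_extend[of f c] unfolding chain_vertices_def by blast

lemma rips_chains_restrict: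
  "c \<in> rips_chains d Y k n \<Longrightarrow> chain_vertices c \<subseteq> X \<Longrightarrow> c \<in> rips_chains d X k n"
  by (auto simp: chain_vertices_def rips_chains_def rips_def)

lemma chain_map_on_restrict:
  assumes F: "chain_map_on (rips d Y i) (rips d Y k) N F" and "X \<subseteq> Y"
    and X: "\<And>x. x \<in> rips d X i \<Longrightarrow> x \<noteq> [] \<Longrightarrow> length x \<le> N \<Longrightarrow> chain_vertices (F x) \<subseteq> X"
  shows "chain_map_on (rips d X i) (rips d X k) N F"
  unfolding chain_map_on_def
proof (intro conjI ballI impI)
  show "F [] = frag_of []" using F by (simp add: chain_map_on_def)
  fix x assume x: "x \<in> rips d X i" "length x \<le> N"
  have xY: "x \<in> rips d Y i" using x rips_mono[OF order_refl \<open>X \<subseteq> Y\<close>] by blast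
  show "bd (F x) = frag_extend F (list_bd x)"
    using F xY x(2) by (simp add: chain_map_on_def)
  show "Poly_Mapping.keys (F x) \<subseteq> {y \<in> rips d X k. length y = length x}"
  proof (cases "x = []")
    case True
    then show ?thesis using F by (simp add: chain_map_on_def rips_def)
  next
    case False
    have "F x \<in> rips_chains d Y k (length x)"
      using chain_map_on_keys[OF F xY x(2)] by (auto simp: rips_chains_def)
    then have "F x \<in> rips_chains d X k (length x)"
      using X[OF x(1) False x(2)] by (rule rips_chains_restrict)
    then show ?thesis by (simp add: rips_chains_def)
  qed
qed

lemma frag_extend_funpow:
  fixes f :: "'a \<Rightarrow> ('a \<Rightarrow>\<^sub>0 int)"
  shows "frag_extend (\<lambda>x. (frag_extend f ^^ s) (g x)) c = (frag_extend f ^^ s) (frag_extend g c)"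
proof (induction s)
  case (Suc s)
  show ?case by (simp add: frag_extend_frag_extend flip: Suc)
qed simp

section \<open>The word metric\<close>

locale fg_group = group G for G :: "('a, 'b) monoid_scheme" (structure) +
  fixes S :: "'a set"
  assumes fin_gen: "finite_generating_set G S"
begin

abbreviation letters :: "'a set" where "letters \<equiv> S \<union> (\<lambda>s. inv s) ` S"

abbreviation evaluate :: "'a list \<Rightarrow> 'a" where "evaluate ws \<equiv> foldr (\<lambda>a b. a \<otimes> b) ws \<one>"

abbreviation dist_w :: "'a \<Rightarrow> 'a \<Rightarrow> real" where "dist_w \<equiv> word_metric G S"

lemma letters_carrier: "letters \<subseteq> carrier G"
  using fin_gen by (auto simp: finite_generating_set_def)

lemma evaluate_closed: "set ws \<subseteq> letters \<Longrightarrow> evaluate ws \<in> carrier G"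
  using letters_carrier by (induction ws) auto

lemma evaluate_append:
  "set us \<subseteq> letters \<Longrightarrow> set vs \<subseteq> letters \<Longrightarrow> evaluate (us @ vs) = evaluate us \<otimes> evaluate vs"
proof (induction us)
  case (Cons a us)
  then have "a \<in> carrier G" using letters_carrier by auto
  with Cons show ?case by (simp add: m_assoc evaluate_closed)
qed (simp add: evaluate_closed)

lemma ex_word:
  assumes "g \<in> carrier G"
  shows "\<exists>ws. set ws \<subseteq> letters \<and> evaluate ws = g"
proof -
  have "g \<in> generate G S" using assms fin_gen by (simp add: finite_generating_set_def)
  then show ?thesis
  proof induction
    case one
    then show ?case by (intro exI[of _ "[]"]) auto
  next
    case (incl h)
    then show ?case using letters_carrier by (intro exI[of _ "[h]"]) auto
  next
    case (inv h)
    then show ?case using letters_carrier by (intro exI[of _ "[inv h]"]) auto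
  next
    case (eng g h)
    then obtain us vs where "set us \<subseteq> letters" "evaluate us = g" "set vs \<subseteq> letters" "evaluate vs = h"
      by blast
    then show ?case by (intro exI[of _ "us @ vs"]) (simp add: evaluate_append del: foldr_append)
  qed
qed

lemma word_length_le: "set ws \<subseteq> letters \<Longrightarrow> word_length G S (evaluate ws) \<le> length ws"
  unfolding word_length_def by (intro Least_le) blast

lemma shortest_word:
  assumes "g \<in> carrier G"
  obtains ws where "length ws = word_length G S g" "set ws \<subseteq> letters" "evaluate ws = g"
proof -
  have "\<exists>n ws. length ws = n \<and> set ws \<subseteq> letters \<and> evaluate ws = g"
    using ex_word[OF assms] by blast
  from LeastI_ex[OF this] show ?thesis
    using that unfolding word_length_def by blast
qed

lemma word_length_mult_le:
  assumes "g \<in> carrier G" "h \<in> carrier G"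
  shows "word_length G S (g \<otimes> h) \<le> word_length G S g + word_length G S h"
proof -
  obtain us where us: "length us = word_length G S g" "set us \<subseteq> letters" "evaluate us = g"
    using shortest_word assms by blast
  obtain vs where vs: "length vs = word_length G S h" "set vs \<subseteq> letters" "evaluate vs = h"
    using shortest_word assms by blast
  show ?thesis
    using word_length_le[of "us @ vs"] us vs by (simp add: evaluate_append del: foldr_append)
qed

lemma dist_w_triangle:
  assumes "a \<in> carrier G" "b \<in> carrier G" "c \<in> carrier G"
  shows "dist_w a c \<le> dist_w a b + dist_w b c"
proof -
  have "b \<otimes> (inv b \<otimes> c) = c"
    using assms by (simp flip: m_assoc)
  then have "inv a \<otimes> c = (inv a \<otimes> b) \<otimes> (inv b \<otimes> c)"
    using assms by (simp add: m_assoc)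
  then show ?thesis
    using word_length_mult_le[of "inv a \<otimes> b" "inv b \<otimes> c"] assms
    by (simp add: word_metric_def)
qed

lemma dist_w_refl: "a \<in> carrier G \<Longrightarrow> dist_w a a = 0"
  using word_length_le[of "[]"] by (simp add: word_metric_def)

lemma dist_w_translate:
  assumes "g \<in> carrier G" "a \<in> carrier G" "b \<in> carrier G"
  shows "dist_w (g \<otimes> a) (g \<otimes> b) = dist_w a b"
proof -
  have "inv g \<otimes> (g \<otimes> b) = b"
    using assms by (simp flip: m_assoc)
  then have "inv (g \<otimes> a) \<otimes> (g \<otimes> b) = inv a \<otimes> b"
    using assms by (simp add: inv_mult_group m_assoc)
  then show ?thesis by (simp add: word_metric_def)
qed

lemma finite_ball: "finite {g \<in> carrier G. real (word_length G S g) \<le> r}"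
proof -
  have "{g \<in> carrier G. real (word_length G S g) \<le> r}
      \<subseteq> evaluate ` {ws. set ws \<subseteq> letters \<and> length ws \<le> nat \<lfloor>r\<rfloor>}"
  proof
    fix g assume g: "g \<in> {g \<in> carrier G. real (word_length G S g) \<le> r}"
    then obtain ws where "length ws = word_length G S g" "set ws \<subseteq> letters" "evaluate ws = g"
      using shortest_word by blast
    with g show "g \<in> evaluate ` {ws. set ws \<subseteq> letters \<and> length ws \<le> nat \<lfloor>r\<rfloor>}"
      by (auto simp: le_nat_floor)
  qed
  moreover have "finite {ws. set ws \<subseteq> letters \<and> length ws \<le> nat \<lfloor>r\<rfloor>}"
    using fin_gen by (intro finite_lists_length_le) (auto simp: finite_generating_set_def)
  ultimately show ?thesis by (meson finite_imageI finite_subset)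
qed

abbreviation ripsG :: "real \<Rightarrow> 'a list set" where "ripsG k \<equiv> rips dist_w (carrier G) k"

abbreviation chainsG :: "real \<Rightarrow> nat \<Rightarrow> ('a list \<Rightarrow>\<^sub>0 int) set"
  where "chainsG k n \<equiv> rips_chains dist_w (carrier G) k n"

text \<open>The vertices of such a simplex lie in the ball of radius \<open>k\<close>, which is
  finite. Up to translation there are thus finitely many simplices of bounded degree: the source of
  all uniform bounds below.\<close>

lemma finite_based_rips: "finite {x \<in> ripsG k. length x \<le> N \<and> hd x = \<one>}"
proof (rule finite_subset)
  show "finite {x. set x \<subseteq> {g \<in> carrier G. real (word_length G S g) \<le> k} \<and> length x \<le> N}"
    by (intro finite_lists_length_le finite_ball)
  show "{x \<in> ripsG k. length x \<le> N \<and> hd x = \<one>}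
      \<subseteq> {x. set x \<subseteq> {g \<in> carrier G. real (word_length G S g) \<le> k} \<and> length x \<le> N}"
  proof safe
    fix x v assume x: "x \<in> ripsG k" "hd x = \<one>" "v \<in> set x"
    then show v: "v \<in> carrier G" by (auto simp: rips_def)
    have "\<one> \<in> set x" using x by (metis hd_in_set empty_iff list.set(1))
    then have "dist_w \<one> v \<le> k" using x by (auto simp: rips_def)
    then show "real (word_length G S v) \<le> k" using v by (simp add: word_metric_def)
  qed
qed

section \<open>Translation and equivariance\<close>

abbreviation shift :: "'a \<Rightarrow> 'a list \<Rightarrow> 'a list" where "shift g \<equiv> map (\<lambda>y. g \<otimes> y)"

abbreviation translate :: "'a \<Rightarrow> ('a list \<Rightarrow>\<^sub>0 int) \<Rightarrow> ('a list \<Rightarrow>\<^sub>0 int)"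
  where "translate g \<equiv> frag_extend (\<lambda>x. frag_of (shift g x))"

lemma group_ring_act_frag_of: "group_ring_act G (frag_of g) c = translate g c"
  by (simp add: group_ring_act_def)

lemma shift_mult: "g \<in> carrier G \<Longrightarrow> h \<in> carrier G \<Longrightarrow> set x \<subseteq> carrier G \<Longrightarrow> shift g (shift h x) = shift (g \<otimes> h) x"
  by (auto simp: m_assoc)

lemma shift_one: "set x \<subseteq> carrier G \<Longrightarrow> shift \<one> x = x"
  by (intro map_idI) auto

lemma shift_rips: "g \<in> carrier G \<Longrightarrow> x \<in> ripsG k \<Longrightarrow> shift g x \<in> ripsG k"
  unfolding rips_def by (auto simp: subset_iff dist_w_translate)

lemma translate_mult:
  assumes "g \<in> carrier G" "h \<in> carrier G" "c \<in> chainsG k n"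
  shows "translate g (translate h c) = translate (g \<otimes> h) c"
  unfolding frag_extend_frag_extend frag_extend_of
  using assms by (intro frag_extend_eq arg_cong[of _ _ frag_of] shift_mult) (auto simp: rips_chains_def rips_def)

lemma translate_chains: "g \<in> carrier G \<Longrightarrow> c \<in> chainsG k n \<Longrightarrow> translate g c \<in> chainsG k n"
  by (erule frag_extend_rips_chains) (simp add: frag_of_rips_chains shift_rips)

lemma chain_vertices_translate: "chain_vertices (translate g c) \<subseteq> (\<lambda>y. g \<otimes> y) ` chain_vertices c"
  using keys_frag_extend[of "\<lambda>x. frag_of (shift g x)" c] by (fastforce simp: chain_vertices_def)

lemma list_bd_shift: "list_bd (shift g x) = translate g (list_bd x)"
proof (induction x)
  case (Cons a x)
  then show ?case by (simp add: frag_extend_diff frag_extend_frag_extend)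
qed simp

lemma bd_translate: "bd (translate g c) = translate g (bd c)"
  by (simp add: frag_extend_frag_extend list_bd_shift)

definition equivariant_on :: "'a list set \<Rightarrow> ('a list \<Rightarrow> ('a list \<Rightarrow>\<^sub>0 int)) \<Rightarrow> bool"
  where "equivariant_on K F \<longleftrightarrow> (\<forall>g\<in>carrier G. \<forall>x\<in>K. F (shift g x) = translate g (F x))"

lemma equivariant_on_extend:
  assumes "equivariant_on K F" "g \<in> carrier G" "Poly_Mapping.keys c \<subseteq> K"
  shows "frag_extend F (translate g c) = translate g (frag_extend F c)"
  unfolding frag_extend_frag_extend
  using assms by (intro frag_extend_eq) (auto simp: equivariant_on_def)

lemma shift_to_one:
  assumes "x \<in> ripsG k" "x \<noteq> []"
  obtains y where "y \<in> ripsG k" "length y = length x" "hd y = \<one>" "x = shift (hd x) y" "y = shift (inv hd x) x"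
proof
  have x: "hd x \<in> carrier G" "set x \<subseteq> carrier G" using assms by (auto simp: rips_def)
  show "shift (inv hd x) x \<in> ripsG k" using shift_rips x assms by simp
  show "hd (shift (inv hd x) x) = \<one>" using x assms by (simp add: hd_map)
  have "shift (hd x) (shift (inv hd x) x) = shift \<one> x"
    using x by (subst shift_mult) auto
  then show "x = shift (hd x) (shift (inv hd x) x)"
    using shift_one x by simp
qed auto

lemma equivariant_on_based:
  assumes F: "equivariant_on {x \<in> ripsG k. length x \<le> N} F"
    and x: "x \<in> ripsG k" "length x \<le> N" "x \<noteq> []" and v: "v \<in> chain_vertices (F x)"
  obtains y w where "y \<in> ripsG k" "length y = length x" "hd y = \<one>" "x = shift (hd x) y"
    "w \<in> chain_vertices (F y)" "v = hd x \<otimes> w"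
proof -
  obtain y where y: "y \<in> ripsG k" "length y = length x" "hd y = \<one>" "x = shift (hd x) y"
    using shift_to_one x by metis
  have "hd x \<in> carrier G" using x by (auto simp: rips_def)
  then have "F x = translate (hd x) (F y)"
    using F y(1,2) x(2) by (subst y(4)) (auto simp: equivariant_on_def)
  then obtain w where "w \<in> chain_vertices (F y)" "v = hd x \<otimes> w"
    using v chain_vertices_translate[of "hd x" "F y"] by auto
  with y that show ?thesis by blast
qed

text \<open>By equivariance \<open>inv hd x \<otimes> v\<close> is a vertex of the image of a
  simplex starting at \<open>\<one>\<close>, and there are finitely many of these. The function
  \<open>B\<close> stays free because it is used for word distances and for the negated
  character.\<close>

lemma equivariant_on_bounded:
  fixes B :: "'a \<Rightarrow> real"
  assumes F: "equivariant_on {x \<in> ripsG k. length x \<le> N} F"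
    and closed: "\<And>x. x \<in> ripsG k \<Longrightarrow> length x \<le> N \<Longrightarrow> chain_vertices (F x) \<subseteq> carrier G"
  obtains E where "0 \<le> E"
    "\<And>x v. x \<in> ripsG k \<Longrightarrow> length x \<le> N \<Longrightarrow> x \<noteq> [] \<Longrightarrow> v \<in> chain_vertices (F x) \<Longrightarrow> B (inv hd x \<otimes> v) \<le> E"
proof
  \<comment> \<open>\<open>W\<close> may be empty; inserting 0 before taking \<open>Max\<close>
    covers that case and makes the bound nonnegative.\<close>
  define W where "W = (\<Union>y\<in>{x \<in> ripsG k. length x \<le> N \<and> hd x = \<one>}. B ` chain_vertices (F y))"
  have "finite W"
    unfolding W_def by (intro finite_UN_I finite_based_rips) (auto simp: chain_vertices_def)
  show "0 \<le> Max (insert 0 W)" using \<open>finite W\<close> by simp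
  fix x v assume x: "x \<in> ripsG k" "length x \<le> N" "x \<noteq> []" and v: "v \<in> chain_vertices (F x)"
  obtain y w where y: "y \<in> ripsG k" "length y = length x" "hd y = \<one>"
    and w: "w \<in> chain_vertices (F y)" "v = hd x \<otimes> w"
    using equivariant_on_based[OF F x v] by metis
  have hd: "hd x \<in> carrier G" using x by (auto simp: rips_def)
  have "w \<in> carrier G" using w closed[of y] y x by auto
  then have "inv hd x \<otimes> v = w" using w hd by (simp flip: m_assoc)
  moreover have "B w \<in> W" unfolding W_def using w y x by auto
  ultimately show "B (inv hd x \<otimes> v) \<le> Max (insert 0 W)" using \<open>finite W\<close> by simp
qed

section \<open>Comparing a large scale with the connecting vector\<close>

text \<open>A list of length \<open>n\<close> is a simplex of degree \<open>n - 1\<close>, whose image has to lie at scale \<open>ks (n - 1)\<close>.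
  Fillings are chosen for simplices starting at \<open>\<one>\<close> and transported by translation.\<close>

lemma connecting_chain_map_exists:
  assumes ks: "\<And>q. q \<le> m \<Longrightarrow> 0 \<le> ks q"
    and vanish: "\<And>q. q < m \<Longrightarrow> VR_homology_vanishes dist_w (carrier G) q (ks q) (ks (Suc q))"
    and "N \<le> Suc m"
  shows "\<exists>F. equivariant_on {x \<in> ripsG i. length x \<le> N} F \<and>
    chain_map_on (ripsG i) {y. y \<in> ripsG (ks (length y - 1))} N F"
  using \<open>N \<le> Suc m\<close>
proof (induction N)
  case 0
  show ?case
    by (intro exI[of _ frag_of]) (auto simp: equivariant_on_def chain_map_on_def rips_def)
next
  case (Suc N)
  show ?case
  proof (cases "N = 0")
    case True
    \<comment> \<open>In degree 0 the inclusion serves even if \<open>i\<close> exceeds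
      \<open>ks 0\<close>: a single vertex is a simplex at every nonnegative scale.\<close>
    have "y \<in> ripsG (ks 0)" if y: "y \<in> ripsG i" "length y \<le> Suc 0" for y
    proof -
      consider "y = []" | a where "y = [a]" using y by (cases y) auto
      then show ?thesis
        using y ks[of 0] by cases (auto simp: rips_def dist_w_refl)
    qed
    then show ?thesis using True
      by (intro exI[of _ frag_of])
        (auto simp: equivariant_on_def chain_map_on_def le_Suc_eq length_Suc_conv simp flip: frag_expansion)
  next
    case False
    let ?L = "{y. y \<in> ripsG (ks (length y - 1))}"
    from Suc obtain F where equi: "equivariant_on {x \<in> ripsG i. length x \<le> N} F"
      and F: "chain_map_on (ripsG i) ?L N F" by auto
    have ex_fill: "\<exists>w. w \<in> chainsG (ks N) (Suc N) \<and> bd w = z"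
      if "z \<in> chainsG (ks (N - 1)) N" "bd z = 0" for z
    proof -
      have "z \<in> bd ` chainsG (ks N) (Suc N)"
        using vanish[of "N - 1"] False Suc.prems that by (simp add: VR_homology_vanishes_iff)
      then show ?thesis by blast
    qed
    define fill where "fill z = (SOME w. w \<in> chainsG (ks N) (Suc N) \<and> bd w = z)" for z
    have fill: "fill z \<in> chainsG (ks N) (Suc N)" "bd (fill z) = z"
      if "z \<in> chainsG (ks (N - 1)) N" "bd z = 0" for z
      using someI_ex[OF ex_fill[OF that]] unfolding fill_def by auto
    \<comment> \<open>The cycle to be filled comes from the translate of \<open>x\<close> that
      starts at \<open>\<one>\<close>, so it is the same for all translates of \<open>x\<close>.
      Translating the chosen filling by \<open>hd x\<close> then gives an equivariant map.\<close>
    define z where "z x = frag_extend F (list_bd (shift (inv hd x) x))" for x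
    have F_chain: "F x \<in> chainsG (ks (N - 1)) N" if "x \<in> ripsG i" "length x = N" for x
      using chain_map_on_keys[OF F that(1)] that(2) by (auto simp: rips_chains_def)
    define F' where "F' x = (if length x = Suc N then translate (hd x) (fill (z x)) else F x)" for x
    have bd_chain: "Poly_Mapping.keys (list_bd x) \<subseteq> {x \<in> ripsG i. length x \<le> N}"
      if "x \<in> ripsG i" "length x \<le> Suc N" for x
      using keys_list_bd[of _ x] rips_subset[OF that(1)] that(2) by fastforce
    have z: "z x \<in> chainsG (ks (N - 1)) N" "bd (z x) = 0"
        "translate (hd x) (z x) = frag_extend F (list_bd x)" "hd x \<in> carrier G"
      if x: "x \<in> ripsG i" "length x = Suc N" for x
    proof -
      show hd: "hd x \<in> carrier G" using x by (cases x) (auto simp: rips_def)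
      obtain y where y: "y \<in> ripsG i" "length y = length x" "x = shift (hd x) y" "y = shift (inv hd x) x"
        using shift_to_one x by (metis length_0_conv nat.distinct(1))
      have zy: "z x = frag_extend F (list_bd y)" by (simp add: z_def flip: y(4))
      show "bd (z x) = 0"
        unfolding zy by (subst chain_map_on_bd[OF F bd_chain]) (use y x in \<open>auto simp: bd_list_bd\<close>)
      have "list_bd y \<in> chainsG i N" using y x by (intro list_bd_rips_chains) auto
      then show "z x \<in> chainsG (ks (N - 1)) N"
        unfolding zy
        by (rule frag_extend_rips_chains) (rule F_chain)
      have "translate (hd x) (z x) = frag_extend F (list_bd (shift (hd x) y))"
        unfolding zy list_bd_shift
        by (rule equivariant_on_extend[OF equi hd bd_chain, symmetric]) (use y x in auto)
      then show "translate (hd x) (z x) = frag_extend F (list_bd x)"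
        using y(3) by simp
    qed
    have F'_chain: "F' x \<in> chainsG (ks N) (Suc N)" "bd (F' x) = frag_extend F (list_bd x)"
      if "x \<in> ripsG i" "length x = Suc N" for x
      using that z[OF that] fill[of "z x"] by (auto simp: F'_def bd_translate translate_chains)
    have ext: "frag_extend F' (list_bd x) = frag_extend F (list_bd x)" if "length x \<le> Suc N" for x
      by (rule frag_extend_eq) (use that in \<open>auto dest!: keys_list_bd simp: F'_def\<close>)
    have "chain_map_on (ripsG i) ?L (Suc N) F'"
      unfolding chain_map_on_def
    proof (intro conjI ballI impI)
      show "F' [] = frag_of []" using F by (simp add: F'_def chain_map_on_def)
      fix x assume x: "x \<in> ripsG i" "length x \<le> Suc N"
      show "Poly_Mapping.keys (F' x) \<subseteq> {y \<in> ?L. length y = length x}"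
      proof (cases "length x = Suc N")
        case True
        then show ?thesis using F'_chain(1)[OF x(1)] by (auto simp: rips_chains_def)
      next
        case False
        then show ?thesis using chain_map_on_keys[OF F x(1)] x(2) by (auto simp: F'_def)
      qed
      show "bd (F' x) = frag_extend F' (list_bd x)"
      proof (cases "length x = Suc N")
        case True
        then show ?thesis using F'_chain(2)[OF x(1)] ext[OF x(2)] by simp
      next
        case False
        then show ?thesis using F x ext[OF x(2)] by (simp add: F'_def chain_map_on_def)
      qed
    qed
    moreover have "equivariant_on {x \<in> ripsG i. length x \<le> Suc N} F'"
      unfolding equivariant_on_def
    proof (intro ballI)
      fix g x assume g: "g \<in> carrier G" and "x \<in> {x \<in> ripsG i. length x \<le> Suc N}"
      then have x: "x \<in> ripsG i" "length x \<le> Suc N" by auto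
      show "F' (shift g x) = translate g (F' x)"
      proof (cases "length x = Suc N")
        case True
        have car: "set x \<subseteq> carrier G" "hd x \<in> carrier G" using x z(4)[OF x(1) True] by (auto simp: rips_def)
        have hd: "hd (shift g x) = g \<otimes> hd x" using True by (cases x) auto
        have "shift (inv (g \<otimes> hd x)) (shift g x) = shift (inv hd x) x"
          using car g by (subst shift_mult) (auto simp: inv_mult_group m_assoc)
        then have "z (shift g x) = z x" by (simp only: z_def hd)
        then show ?thesis
          using True hd translate_mult[OF g car(2) fill(1)[OF z(1,2)[OF x(1) True]]]
          by (simp add: F'_def)
      next
        case False
        then show ?thesis using equi g x by (simp add: F'_def equivariant_on_def)
      qed
    qed
    ultimately show ?thesis by blast
  qed
qed

section \<open>Raising the character\<close>

lemma character_mult: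
  "\<chi> \<in> characters G \<Longrightarrow> a \<in> carrier G \<Longrightarrow> b \<in> carrier G \<Longrightarrow> \<chi> (a \<otimes> b) = \<chi> a + \<chi> b"
  using hom_mult[of \<chi> G additive_real_group] by (simp add: characters_def additive_real_group_def)

lemma character_diff:
  assumes "\<chi> \<in> characters G" "a \<in> carrier G" "b \<in> carrier G"
  shows "\<chi> (inv a \<otimes> b) = \<chi> b - \<chi> a"
  using character_mult[of \<chi> a "inv a \<otimes> b"] assms by (simp flip: m_assoc)

text \<open>Left invariance turns the distances between \<open>hd x\<close> and \<open>v\<close>, in
  both directions, into those between \<open>\<one>\<close> and \<open>inv hd x \<otimes> v\<close>,
  which \<open>equivariant_on_bounded\<close> controls.\<close>

lemma equivariant_on_near:
  assumes "equivariant_on {x \<in> ripsG k. length x \<le> N} F"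
    and F: "chain_map_on (ripsG k) (ripsG l) N F"
  obtains E where "0 \<le> E"
    "\<And>x v. x \<in> ripsG k \<Longrightarrow> length x \<le> N \<Longrightarrow> x \<noteq> [] \<Longrightarrow> v \<in> chain_vertices (F x)
      \<Longrightarrow> dist_w (hd x) v \<le> E \<and> dist_w v (hd x) \<le> E"
proof -
  have closed: "chain_vertices (F x) \<subseteq> carrier G" if "x \<in> ripsG k" "length x \<le> N" for x
    using chain_map_on_keys[OF F that] by (auto simp: chain_vertices_def rips_def)
  define B where "B g = max (dist_w \<one> g) (dist_w g \<one>)" for g
  obtain E where E: "0 \<le> E" "\<And>x v. x \<in> ripsG k \<Longrightarrow> length x \<le> N \<Longrightarrow> x \<noteq> []
      \<Longrightarrow> v \<in> chain_vertices (F x) \<Longrightarrow> B (inv hd x \<otimes> v) \<le> E"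
    using equivariant_on_bounded[OF assms(1) closed, where B = B] by metis
  show ?thesis
  proof
    show "0 \<le> E" by fact
    fix x v assume x: "x \<in> ripsG k" "length x \<le> N" "x \<noteq> []" "v \<in> chain_vertices (F x)"
    have c: "hd x \<in> carrier G" "v \<in> carrier G" using x closed by (auto simp: rips_def)
    have "dist_w (hd x \<otimes> \<one>) (hd x \<otimes> (inv hd x \<otimes> v)) = dist_w \<one> (inv hd x \<otimes> v)"
      "dist_w (hd x \<otimes> (inv hd x \<otimes> v)) (hd x \<otimes> \<one>) = dist_w (inv hd x \<otimes> v) \<one>"
      using c by (intro dist_w_translate; simp)+
    moreover have "hd x \<otimes> (inv hd x \<otimes> v) = v" using c by (simp flip: m_assoc)
    ultimately show "dist_w (hd x) v \<le> E \<and> dist_w v (hd x) \<le> E"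
      using E(2)[OF x] c by (simp add: B_def)
  qed
qed

section \<open>The given endomorphism as an equivariant chain map on lists\<close>

text \<open>Merges the family \<open>\<phi>\<close> into one function, \<open>length x - 1\<close>
  being the degree. The value on the empty list encodes the identity on the integers.\<close>

definition simplex_map :: "(nat \<Rightarrow> ('a list \<Rightarrow>\<^sub>0 int) \<Rightarrow> ('a list \<Rightarrow>\<^sub>0 int)) \<Rightarrow> 'a list \<Rightarrow> ('a list \<Rightarrow>\<^sub>0 int)"
  where "simplex_map \<phi> x = (if x = [] then frag_of [] else \<phi> (length x - 1) (frag_of x))"

text \<open>Extending the identity becomes the boundary identity for one-element lists, the chain
  condition gives it for longer ones, and linearity applied to \<open>frag_of g\<close> gives
  equivariance.\<close>

lemma VR_chain_endomorphism_simplex_map: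
  assumes endo: "VR_chain_endomorphism G S m k \<phi>" and ext: "extends_identity G S k \<phi>"
  shows "chain_map_on (ripsG k) (ripsG k) (Suc m) (simplex_map \<phi>)"
    and "equivariant_on {x \<in> ripsG k. length x \<le> Suc m} (simplex_map \<phi>)"
proof -
  let ?C = "VR_chains dist_w (carrier G) k"
  have hom: "\<phi> q \<in> hom (?C q) (?C q)" if "q \<le> m" for q
    using endo that by (auto simp: VR_chain_endomorphism_def Let_def group_ring_linear_def)
  have extend: "\<phi> q c = frag_extend (simplex_map \<phi>) c" if "q \<le> m" "c \<in> chainsG k (Suc q)" for q c
  proof -
    have "\<phi> q c = frag_extend (\<lambda>x. \<phi> q (frag_of x)) c"
      by (rule hom_frag_eq_extend[OF hom[OF that(1), unfolded VR_chains_def]])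
        (use that(2) in \<open>simp add: VR_simplices_eq_rips rips_chains_def\<close>)
    also have "\<dots> = frag_extend (simplex_map \<phi>) c"
      by (rule frag_extend_eq) (use that(2) in \<open>auto simp: simplex_map_def rips_chains_def\<close>)
    finally show ?thesis .
  qed
  have closed: "\<phi> q (frag_of x) \<in> chainsG k (Suc q)" if "q \<le> m" "x \<in> ripsG k" "length x = Suc q" for q x
    using hom_in_carrier[OF hom[OF that(1)], of "frag_of x"] that
    by (simp add: carrier_VR_chains frag_of_rips_chains)
  show "chain_map_on (ripsG k) (ripsG k) (Suc m) (simplex_map \<phi>)"
    unfolding chain_map_on_def
  proof (intro conjI ballI impI)
    show "simplex_map \<phi> [] = frag_of []" by (simp add: simplex_map_def)
    fix x assume x: "x \<in> ripsG k" "length x \<le> Suc m"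
    show "Poly_Mapping.keys (simplex_map \<phi> x) \<subseteq> {y \<in> ripsG k. length y = length x}"
      using x closed[of "length x - 1" x] by (cases x) (auto simp: simplex_map_def rips_chains_def)
    show "bd (simplex_map \<phi> x) = frag_extend (simplex_map \<phi>) (list_bd x)"
    proof (cases x)
      case Nil
      then show ?thesis by (simp add: simplex_map_def)
    next
      case (Cons a xs)
      let ?q = "length xs"
      have q: "?q \<le> m" "length x = Suc ?q" "simplex_map \<phi> x = \<phi> ?q (frag_of x)"
        using Cons x by (auto simp: simplex_map_def)
      have fx: "frag_of x \<in> chainsG k (Suc ?q)" using x q by (simp add: frag_of_rips_chains)
      have px: "\<phi> ?q (frag_of x) \<in> chainsG k (Suc ?q)" using closed x q by blast
      show ?thesis
      proof (cases ?q)
        case 0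
        have "bd (\<phi> 0 (frag_of x)) = frag_cmul (augmentation (\<phi> 0 (frag_of x))) (frag_of [])"
          using px 0 by (intro bd_eq_augmentation) (auto simp: rips_chains_def)
        also have "augmentation (\<phi> 0 (frag_of x)) = augmentation (frag_of x)"
          using ext fx 0 by (simp add: extends_identity_def carrier_VR_chains)
        finally show ?thesis
          using 0 q Cons by (simp add: augmentation_def simplex_map_def)
      next
        case (Suc p)
        have "VR_boundary (Suc p) (\<phi> (Suc p) (frag_of x)) = \<phi> p (VR_boundary (Suc p) (frag_of x))"
          using endo q fx Suc by (auto simp: VR_chain_endomorphism_def Let_def carrier_VR_chains)
        moreover have "VR_boundary (Suc p) (\<phi> (Suc p) (frag_of x)) = bd (\<phi> (Suc p) (frag_of x))"
          using px Suc by (intro VR_boundary_eq_bd) (auto simp: rips_chains_def)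
        moreover have "VR_boundary (Suc p) (frag_of x) = bd (frag_of x)"
          using q(2) Suc by (intro VR_boundary_eq_bd) auto
        moreover have "\<phi> p (bd (frag_of x)) = frag_extend (simplex_map \<phi>) (bd (frag_of x))"
          using fx q(1) Suc by (intro extend bd_rips_chains) auto
        ultimately show ?thesis using q Suc by simp
      qed
    qed
  qed
  show "equivariant_on {x \<in> ripsG k. length x \<le> Suc m} (simplex_map \<phi>)"
    unfolding equivariant_on_def
  proof (intro ballI)
    fix g x assume g: "g \<in> carrier G" and "x \<in> {x \<in> ripsG k. length x \<le> Suc m}"
    then have x: "x \<in> ripsG k" "length x \<le> Suc m" by auto
    show "simplex_map \<phi> (shift g x) = translate g (simplex_map \<phi> x)"
    proof (cases x)
      case Nil
      then show ?thesis by (simp add: simplex_map_def)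
    next
      case (Cons a xs)
      let ?q = "length xs"
      have q: "?q \<le> m" "length x = Suc ?q" using Cons x by auto
      have "\<phi> ?q (group_ring_act G a c) = group_ring_act G a (\<phi> ?q c)"
        if "Poly_Mapping.keys a \<subseteq> carrier G" "c \<in> carrier (?C ?q)" for a c
        using endo q that unfolding VR_chain_endomorphism_def Let_def group_ring_linear_def by blast
      from this[of "frag_of g" "frag_of x"]
      have "\<phi> ?q (translate g (frag_of x)) = translate g (\<phi> ?q (frag_of x))"
        using g x q by (simp add: carrier_VR_chains frag_of_rips_chains group_ring_act_frag_of)
      then show ?thesis using Cons by (simp add: simplex_map_def)
    qed
  qed
qed

text \<open>\<open>u_val\<close> inspects only simplices starting at \<open>\<one>\<close>, but
  translation by \<open>hd x\<close> adds \<open>\<chi> (hd x)\<close> to both minima and leaves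
  their difference unchanged. The gain \<open>u\<close> is thus valid for every simplex.\<close>

lemma u_val_raises:
  assumes \<chi>: "\<chi> \<in> characters G" and u: "u_val G S m k \<phi> \<chi> \<in> {0<..<\<infinity>}"
    and equi: "equivariant_on {x \<in> ripsG k. length x \<le> Suc m} (simplex_map \<phi>)"
    and closed: "\<And>x. x \<in> ripsG k \<Longrightarrow> length x \<le> Suc m \<Longrightarrow> chain_vertices (simplex_map \<phi> x) \<subseteq> carrier G"
  obtains u where "0 < u"
    "\<And>x r v. x \<in> ripsG k \<Longrightarrow> length x \<le> Suc m \<Longrightarrow> x \<noteq> [] \<Longrightarrow> \<forall>w\<in>set x. r \<le> \<chi> w
      \<Longrightarrow> v \<in> chain_vertices (simplex_map \<phi> x) \<Longrightarrow> r + u \<le> \<chi> v"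
proof -
  obtain u where uv: "u_val G S m k \<phi> \<chi> = ereal u" "0 < u"
    using u by (cases "u_val G S m k \<phi> \<chi>") auto
  show ?thesis
  proof
    show "0 < u" by fact
    fix x r v
    assume x: "x \<in> ripsG k" "length x \<le> Suc m" "x \<noteq> []"
      and r: "\<forall>w\<in>set x. r \<le> \<chi> w" and v: "v \<in> chain_vertices (simplex_map \<phi> x)"
    obtain y w where y: "y \<in> ripsG k" "length y = length x" "hd y = \<one>" "x = shift (hd x) y"
      and w: "w \<in> chain_vertices (simplex_map \<phi> y)" "v = hd x \<otimes> w"
      using equivariant_on_based[OF equi x v] by metis
    have c: "hd x \<in> carrier G" "w \<in> carrier G" "set y \<subseteq> carrier G"
      using x w closed[of y] y by (auto simp: rips_def)
    define q where "q = length x - 1"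
    have q: "q \<le> m" "length y = Suc q" "y \<noteq> []" using x y by (auto simp: q_def)
    have "ereal u \<le> (INF g\<in>chain_vertices (\<phi> q (frag_of y)). ereal (\<chi> g)) - (INF g\<in>set y. ereal (\<chi> g))"
      unfolding uv(1)[symmetric] u_val_def
      by (rule INF_lower2[of q], use q in simp, rule INF_lower)
        (use y q in \<open>auto simp: VR_simplices_eq_rips hd_conv_nth\<close>)
    \<comment> \<open>The first infimum is at most \<open>\<chi> w\<close>; the subtracted one is at
      least \<open>r - \<chi> (hd x)\<close>, since \<open>\<chi>\<close> is at least
      \<open>r\<close> on the translate \<open>x\<close> of \<open>y\<close>.\<close>
    also have "\<dots> \<le> ereal (\<chi> w) - ereal (r - \<chi> (hd x))"
    proof (rule ereal_minus_mono)
      show "(INF g\<in>chain_vertices (\<phi> q (frag_of y)). ereal (\<chi> g)) \<le> ereal (\<chi> w)"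
        by (rule INF_lower) (use w q in \<open>auto simp: simplex_map_def\<close>)
      have "r - \<chi> (hd x) \<le> \<chi> g" if "g \<in> set y" for g
      proof -
        have "hd x \<otimes> g \<in> set x" using that by (subst y(4)) auto
        then have "r \<le> \<chi> (hd x \<otimes> g)" using r by blast
        moreover have "g \<in> carrier G" using that c(3) by blast
        ultimately show ?thesis using character_mult[OF \<chi> c(1)] by simp
      qed
      then show "ereal (r - \<chi> (hd x)) \<le> (INF g\<in>set y. ereal (\<chi> g))"
        by (intro INF_greatest) simp
    qed
    finally show "r + u \<le> \<chi> v"
      using w(2) character_mult[OF \<chi> c(1,2)] by simp
  qed
qed

section \<open>Iterates of a chain map that raises the character\<close>

lemma funpow_chain_map:
  assumes F: "chain_map_on (ripsG k) (ripsG k) N F" and c: "c \<in> chainsG k n" "n \<le> N"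
  shows "(frag_extend F ^^ s) c \<in> chainsG k n"
    and "bd ((frag_extend F ^^ s) c) = (frag_extend F ^^ s) (bd c)"
proof -
  show mem: "(frag_extend F ^^ s) c \<in> chainsG k n" for s
    using chain_map_on_rips_chains(1)[OF F _ c(2)] c(1) by (induction s) auto
  show "bd ((frag_extend F ^^ s) c) = (frag_extend F ^^ s) (bd c)"
    using chain_map_on_rips_chains(2)[OF F mem c(2)] by (induction s) auto
qed

lemma funpow_equivariant:
  assumes F: "chain_map_on (ripsG k) (ripsG k) N F" "equivariant_on {x \<in> ripsG k. length x \<le> N} F"
    and c: "c \<in> chainsG k n" "n \<le> N" "g \<in> carrier G"
  shows "(frag_extend F ^^ s) (translate g c) = translate g ((frag_extend F ^^ s) c)"
proof (induction s)
  case (Suc s)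
  have "Poly_Mapping.keys ((frag_extend F ^^ s) c) \<subseteq> {x \<in> ripsG k. length x \<le> N}"
    using funpow_chain_map(1)[OF F(1) c(1,2), of s] c(2) by (auto simp: rips_chains_def)
  with Suc show ?case
    by (simp add: equivariant_on_extend[OF F(2) c(3)])
qed simp

text \<open>Each application gains another \<open>u\<close>. The condition \<open>0 < n\<close>
  excludes the empty list, about which \<open>raise\<close> says nothing.\<close>

lemma funpow_raises:
  assumes F: "chain_map_on (ripsG k) (ripsG k) N F"
    and raise: "\<And>x r v. x \<in> ripsG k \<Longrightarrow> length x \<le> N \<Longrightarrow> x \<noteq> [] \<Longrightarrow> \<forall>w\<in>set x. r \<le> \<chi> w
      \<Longrightarrow> v \<in> chain_vertices (F x) \<Longrightarrow> r + u \<le> \<chi> v"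
    and c: "c \<in> chainsG k n" "0 < n" "n \<le> N" "\<And>v. v \<in> chain_vertices c \<Longrightarrow> r \<le> \<chi> v"
  shows "v \<in> chain_vertices ((frag_extend F ^^ s) c) \<Longrightarrow> r + real s * u \<le> \<chi> v"
proof (induction s arbitrary: v)
  case 0
  then show ?case using c(4) by simp
next
  case (Suc s)
  obtain x where x: "x \<in> Poly_Mapping.keys ((frag_extend F ^^ s) c)" "v \<in> chain_vertices (F x)"
    using Suc.prems chain_vertices_frag_extend[of F "(frag_extend F ^^ s) c"] by auto
  have "x \<in> ripsG k" "length x \<le> N" "x \<noteq> []"
    using x(1) funpow_chain_map(1)[OF F c(1,3), of s] c(2,3) by (auto simp: rips_chains_def)
  moreover have "\<forall>w\<in>set x. r + real s * u \<le> \<chi> w"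
    using Suc.IH x(1) by (auto simp: chain_vertices_def)
  ultimately have "(r + real s * u) + u \<le> \<chi> v"
    using x(2) by (intro raise)
  then show ?case by (simp add: algebra_simps)
qed

section \<open>Vanishing of homology in the half space\<close>

lemma halfspace_homology_vanishes:
  assumes ks: "\<And>q. q \<le> m \<Longrightarrow> 0 \<le> ks q"
    and vanish: "\<And>q. q < m \<Longrightarrow> VR_homology_vanishes dist_w (carrier G) q (ks q) (ks (Suc q))"
    and k: "\<And>q. q \<le> m \<Longrightarrow> ks q \<le> k"
    and F: "chain_map_on (ripsG k) (ripsG k) (Suc m) F"
    and equi: "equivariant_on {x \<in> ripsG k. length x \<le> Suc m} F"
    and \<chi>: "\<chi> \<in> characters G" and "0 < u"
    and raise: "\<And>x r v. x \<in> ripsG k \<Longrightarrow> length x \<le> Suc m \<Longrightarrow> x \<noteq> []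
      \<Longrightarrow> \<forall>w\<in>set x. r \<le> \<chi> w \<Longrightarrow> v \<in> chain_vertices (F x) \<Longrightarrow> r + u \<le> \<chi> v"
    and "q < m"
  shows "\<exists>j\<ge>i. VR_homology_vanishes dist_w {g \<in> carrier G. 0 \<le> \<chi> g} q i j"
proof -
  define X where "X = {g \<in> carrier G. 0 \<le> \<chi> g}"
  define P where "P = frag_extend F"
  define n where "n = Suc q"
  have n: "n \<le> m" "0 < n" "n \<le> Suc m" "Suc n \<le> Suc m" using \<open>q < m\<close> by (auto simp: n_def)
  have XG: "X \<subseteq> carrier G" by (auto simp: X_def)
  have ripsXG: "rips dist_w X j \<subseteq> ripsG j" for j by (rule rips_mono[OF order_refl XG])
  have triangle: "dist_w a c \<le> dist_w a b + dist_w b c" if "a \<in> X" "b \<in> X" "c \<in> X" for a b c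
    using that by (intro dist_w_triangle) (auto simp: X_def)
  have P_raises: "r + real s * u \<le> \<chi> v"
    if "c \<in> chainsG k n" "0 < n" "n \<le> Suc m" "\<And>v. v \<in> chain_vertices c \<Longrightarrow> r \<le> \<chi> v"
      "v \<in> chain_vertices ((P ^^ s) c)" for c n r s v
    using F raise that unfolding P_def by (rule funpow_raises)
  note P_chain = funpow_chain_map[OF F, folded P_def]
  have FX: "chain_vertices (F x) \<subseteq> carrier G" if "x \<in> ripsG k" "length x \<le> Suc m" for x
    using chain_map_on_keys[OF F that] by (auto simp: chain_vertices_def rips_def)

  \<comment> \<open>Length at most \<open>n\<close> means degree at most \<open>q\<close>. The next
    entry \<open>ks n\<close> of the connecting vector is kept for filling the image of the
    cycle.\<close>
  have "\<exists>a. equivariant_on {x \<in> ripsG i. length x \<le> n} a \<and>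
      chain_map_on (ripsG i) {y. y \<in> ripsG (ks (length y - 1))} n a"
    using ks vanish n(3) by (rule connecting_chain_map_exists)
  then obtain a where a_equi: "equivariant_on {x \<in> ripsG i. length x \<le> n} a"
    and a: "chain_map_on (ripsG i) {y. y \<in> ripsG (ks (length y - 1))} n a"
    by (elim exE conjE)
  have a_chain: "a x \<in> chainsG (ks (length x - 1)) (length x)" if "x \<in> ripsG i" "length x \<le> n" for x
    using chain_map_on_keys[OF a that] by (auto simp: rips_chains_def)
  have a_chain_k: "a x \<in> chainsG k (length x)" if "x \<in> ripsG i" "length x \<le> n" for x
  proof (rule subsetD[OF rips_chains_mono[OF k subset_refl] a_chain[OF that]])
    show "length x - 1 \<le> m" using that n by simp
  qed
  \<comment> \<open>With the negated character as \<open>B\<close>, the number \<open>A\<close>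
    bounds how far \<open>a\<close> can drop below the value of \<open>\<chi>\<close> at the head;
    then \<open>s\<close> applications of \<open>P\<close> make up for this loss.\<close>
  obtain A where A: "0 \<le> A" "\<And>x v. x \<in> ripsG i \<Longrightarrow> length x \<le> n \<Longrightarrow> x \<noteq> []
      \<Longrightarrow> v \<in> chain_vertices (a x) \<Longrightarrow> - \<chi> (inv hd x \<otimes> v) \<le> A"
    using a_equi chain_vertices_rips_chains[OF a_chain]
    by (rule equivariant_on_bounded[where B = "\<lambda>g. - \<chi> g"]) (assumption | rule that)+
  obtain s where s: "A \<le> real s * u" using reals_Archimedean3[OF \<open>0 < u\<close>, rule_format, of A] by (auto intro: less_imp_le)

  \<comment> \<open>\<open>a\<close> and \<open>f\<close> are the maps \<open>\<alpha>\<close> and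
    \<open>\<psi>\<close> of the overview, given on simplices.\<close>
  define f where "f x = (P ^^ s) (a x)" for x
  have ext_f: "frag_extend f c = (P ^^ s) (frag_extend a c)" for c
    unfolding f_def P_def by (rule frag_extend_funpow)
  have f_map: "chain_map_on (ripsG i) (ripsG k) n f"
    unfolding chain_map_on_def
  proof (intro conjI ballI impI)
    have "(P ^^ t) (frag_of []) = frag_of []" for t
      using F by (induction t) (simp_all add: P_def chain_map_on_def)
    then show "f [] = frag_of []" using a by (simp add: f_def chain_map_on_def)
    fix x assume x: "x \<in> ripsG i" "length x \<le> n"
    have len: "length x \<le> Suc m" using x n by simp
    show "Poly_Mapping.keys (f x) \<subseteq> {y \<in> ripsG k. length y = length x}"
      using P_chain(1)[OF a_chain_k[OF x] len, of s] by (simp add: f_def rips_chains_def)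
    show "bd (f x) = frag_extend f (list_bd x)"
      using P_chain(2)[OF a_chain_k[OF x] len, of s] a x by (simp add: ext_f f_def[of x] chain_map_on_def)
  qed
  have f_equi: "equivariant_on {x \<in> ripsG i. length x \<le> n} f"
    unfolding equivariant_on_def
  proof (intro ballI)
    fix g x assume g: "g \<in> carrier G" and x: "x \<in> {x \<in> ripsG i. length x \<le> n}"
    then have "a (shift g x) = translate g (a x)" using a_equi by (simp add: equivariant_on_def)
    then show "f (shift g x) = translate g (f x)"
      using funpow_equivariant[OF F equi a_chain_k _ g, of x s] x n by (simp add: f_def P_def)
  qed
  have f_X: "chain_map_on (rips dist_w X i) (rips dist_w X k) n f"
  proof (rule chain_map_on_restrict[OF f_map XG])
    fix x assume xX: "x \<in> rips dist_w X i" and x: "x \<noteq> []" "length x \<le> n"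
    have xG: "x \<in> ripsG i" using xX ripsXG by blast
    have "hd x \<in> X" using xX x(1) hd_in_set by (auto simp: rips_def)
    then have hd: "hd x \<in> carrier G" "0 \<le> \<chi> (hd x)" by (simp_all add: X_def)
    have "- A \<le> \<chi> w" if w: "w \<in> chain_vertices (a x)" for w
    proof -
      have "w \<in> carrier G" using w chain_vertices_rips_chains[OF a_chain[OF xG x(2)]] by blast
      then show ?thesis using A(2)[OF xG x(2,1) w] hd by (simp add: character_diff[OF \<chi>])
    qed
    then have "- A + real s * u \<le> \<chi> v" if "v \<in> chain_vertices (f x)" for v
      using that x n unfolding f_def by (intro P_raises[OF a_chain_k[OF xG x(2)]]) auto
    moreover have "chain_vertices (f x) \<subseteq> carrier G"
      using P_chain(1)[OF a_chain_k[OF xG x(2)]] x n unfolding f_def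
      by (intro chain_vertices_rips_chains) auto
    ultimately show "chain_vertices (f x) \<subseteq> X" using s by (force simp: X_def)
  qed
  have F_G: "chain_map_on (ripsG k) (ripsG k) n F" and F_equi: "equivariant_on {x \<in> ripsG k. length x \<le> n} F"
    using F equi n by (auto simp: chain_map_on_def equivariant_on_def)
  have F_X: "chain_map_on (rips dist_w X k) (rips dist_w X k) n F"
  proof (rule chain_map_on_restrict[OF F_G XG])
    fix x assume xX: "x \<in> rips dist_w X k" and x: "x \<noteq> []" "length x \<le> n"
    have "0 + u \<le> \<chi> v" if "v \<in> chain_vertices (F x)" for v
      using that xX x n ripsXG by (intro raise[of x]) (auto simp: rips_def X_def)
    then show "chain_vertices (F x) \<subseteq> X"
      using FX[of x] xX x n ripsXG \<open>0 < u\<close> by (force simp: X_def)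
  qed

  obtain E1 where E1: "0 \<le> E1" "\<And>x v. x \<in> ripsG i \<Longrightarrow> length x \<le> n \<Longrightarrow> x \<noteq> [] \<Longrightarrow> v \<in> chain_vertices (f x)
      \<Longrightarrow> dist_w (hd x) v \<le> E1 \<and> dist_w v (hd x) \<le> E1"
    by (rule equivariant_on_near[OF f_equi f_map]) (assumption | rule that)+
  obtain E2 where E2: "0 \<le> E2" "\<And>x v. x \<in> ripsG k \<Longrightarrow> length x \<le> n \<Longrightarrow> x \<noteq> [] \<Longrightarrow> v \<in> chain_vertices (F x)
      \<Longrightarrow> dist_w (hd x) v \<le> E2 \<and> dist_w v (hd x) \<le> E2"
    by (rule equivariant_on_near[OF F_equi F_G]) (assumption | rule that)+
  \<comment> \<open>Fixed before any cycle is given: \<open>E1\<close> and \<open>E2\<close> come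
    from \<open>f\<close> and \<open>F\<close>, not from \<open>z\<close>. The number
    \<open>t\<close> chosen later does depend on \<open>z\<close>, but does not enter the
    scale.\<close>
  define j where "j = max (i + 2 * E1) (k + 2 * E2)"
  have j: "i \<le> j" "k \<le> j" "i + 2 * E1 \<le> j" "k + 2 * E2 \<le> j" using E1(1) E2(1) by (auto simp: j_def)
  define B where "B = bd ` rips_chains dist_w X j (Suc n)"
  have B_I: "bd ` rips_chains dist_w X l (Suc n) \<subseteq> B" if "l \<le> j" for l
    unfolding B_def using rips_chains_mono[OF that subset_refl] by blast
  have B_add: "x + y \<in> B" if "x \<in> B" "y \<in> B" for x y
    using that by (auto simp: B_def rips_chains_add simp flip: frag_extend_add)
  have B_diff: "x - y \<in> B" if "x \<in> B" "y \<in> B" for x y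
    using that by (auto simp: B_def rips_chains_diff simp flip: frag_extend_diff)

  have "z \<in> B" if z: "z \<in> rips_chains dist_w X i n" "bd z = 0" for z
  proof -
    have zG: "z \<in> chainsG i n" using z rips_chains_mono[OF order_refl XG] by blast
    define y where "y = frag_extend f z"
    have "y - z \<in> bd ` rips_chains dist_w X (i + 2 * E1) (Suc n)"
      unfolding y_def using E1 ripsXG z
      by (intro chain_map_homotopic_id[OF triangle f_X]) auto
    then have yz: "y - z \<in> B" using B_I j by blast
    have y: "y \<in> rips_chains dist_w X k n" "bd y = 0"
      using chain_map_on_rips_chains[OF f_X z(1)] z(2) by (auto simp: y_def)
    \<comment> \<open>Telescoping: consecutive iterates differ by a boundary at scale
      \<open>k + 2 * E2\<close>, and adding boundaries does not enlarge the scale.\<close>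
    have P_y: "(P ^^ t) y \<in> rips_chains dist_w X k n \<and> bd ((P ^^ t) y) = 0 \<and> (P ^^ t) y - z \<in> B" for t
    proof (induction t)
      case 0
      then show ?case using y yz by simp
    next
      case (Suc t)
      let ?y = "(P ^^ t) y"
      have "frag_extend F ?y - ?y \<in> bd ` rips_chains dist_w X (k + 2 * E2) (Suc n)"
        using E2 ripsXG Suc.IH
        by (intro chain_map_homotopic_id[OF triangle F_X]) auto
      then have "(frag_extend F ?y - ?y) + (?y - z) \<in> B" using B_I j Suc.IH B_add by blast
      then show ?case
        using chain_map_on_rips_chains[OF F_X, of ?y n] Suc.IH by (simp add: P_def)
    qed
    \<comment> \<open>The exact scale \<open>ks q\<close> matters: there the connecting vector
      provides fillings, whereas \<open>k\<close> may be larger.\<close>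
    have az: "frag_extend a z \<in> chainsG (ks q) n"
    proof (rule frag_extend_rips_chains[OF zG])
      show "a x \<in> chainsG (ks q) n" if "x \<in> ripsG i" "length x = n" for x
        using a_chain[of x] that by (simp add: n_def)
    qed
    have "Poly_Mapping.keys z \<subseteq> {x \<in> ripsG i. length x \<le> n}"
      using zG by (auto simp: rips_chains_def)
    from chain_map_on_bd[OF a this] have "bd (frag_extend a z) = 0"
      by (simp add: z(2))
    with az have "frag_extend a z \<in> bd ` chainsG (ks n) (Suc n)"
      using vanish[OF \<open>q < m\<close>] by (simp add: VR_homology_vanishes_iff n_def)
    then obtain w where w: "w \<in> chainsG (ks n) (Suc n)" "bd w = frag_extend a z"
      by (metis imageE)
    have wk: "w \<in> chainsG k (Suc n)"
      using w(1) rips_chains_mono[OF k[OF n(1)] subset_refl] by blast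
    \<comment> \<open>The 0 is inserted because \<open>w\<close> may have no vertices.\<close>
    define r where "r = Min (insert 0 (\<chi> ` chain_vertices w))"
    have r: "r \<le> \<chi> v" if "v \<in> chain_vertices w" for v
      unfolding r_def using that by (intro Min_le) (auto simp: chain_vertices_def)
    obtain t where t: "- r \<le> real t * u"
      using reals_Archimedean3[OF \<open>0 < u\<close>, rule_format, of "- r"] by (auto intro: less_imp_le)
    \<comment> \<open>Already \<open>t\<close> applications lift \<open>w\<close> into the half
      space. The further \<open>s\<close> make the boundary equal to \<open>(P ^^ t) y\<close>,
      since \<open>y\<close> is \<open>(P ^^ s) (frag_extend a z)\<close>.\<close>
    have "0 \<le> \<chi> v" if "v \<in> chain_vertices ((P ^^ (t + s)) w)" for v
    proof -
      have "r + real (t + s) * u \<le> \<chi> v"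
        by (rule P_raises[OF wk _ n(4) r that]) simp
      moreover have "0 \<le> real s * u" using \<open>0 < u\<close> by simp
      ultimately show ?thesis using t by (simp add: algebra_simps)
    qed
    moreover have Pw: "(P ^^ (t + s)) w \<in> chainsG k (Suc n)"
      by (rule P_chain(1)[OF wk n(4)])
    ultimately have "chain_vertices ((P ^^ (t + s)) w) \<subseteq> X"
      using chain_vertices_rips_chains[OF Pw] by (simp add: X_def subset_iff)
    with Pw have "(P ^^ (t + s)) w \<in> rips_chains dist_w X k (Suc n)"
      by (rule rips_chains_restrict)
    then have "bd ((P ^^ (t + s)) w) \<in> B" using B_I j by blast
    moreover have "bd ((P ^^ (t + s)) w) = (P ^^ t) y"
      unfolding P_chain(2)[OF wk n(4)] w(2) y_def ext_f by (simp add: funpow_add)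
    \<comment> \<open>Both \<open>(P ^^ t) y\<close> and its difference from \<open>z\<close> are
      boundaries at scale \<open>j\<close>, hence so is \<open>z\<close>.\<close>
    ultimately have "(P ^^ t) y - ((P ^^ t) y - z) \<in> B" using P_y B_diff by metis
    then show ?thesis by simp
  qed
  then have "VR_homology_vanishes dist_w X q i j"
    unfolding VR_homology_vanishes_iff using j by (auto simp: B_def n_def)
  then show ?thesis using j(1) unfolding X_def by blast
qed

end

theorem proposition4p5:
  fixes G :: "('a, 'b) monoid_scheme" and S :: "'a set" and m :: nat and ks :: "nat \<Rightarrow> real"
    and k :: real and \<phi> :: "nat \<Rightarrow> ('a list \<Rightarrow>\<^sub>0 int) \<Rightarrow> ('a list \<Rightarrow>\<^sub>0 int)"
  assumes "group G"
    and "finite_generating_set G S"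
    and "homological_connecting_vector G S m ks"
    and "k = Max (ks ` {0..m})"
    and "VR_chain_endomorphism G S m k \<phi>"
    and "extends_identity G S k \<phi>"
  shows "U_set G S m k \<phi> \<subseteq> Sigma_inv G S m"
proof
  interpret fg_group G S
    using assms(1,2) by (simp add: fg_group_def fg_group_axioms_def)
  fix \<chi> assume "\<chi> \<in> U_set G S m k \<phi>"
  then have \<chi>: "\<chi> \<in> characters G" "u_val G S m k \<phi> \<chi> \<in> {0<..<\<infinity>}"
    by (auto simp: U_set_def)
  note F = VR_chain_endomorphism_simplex_map[OF assms(5,6)]
  have closed: "chain_vertices (simplex_map \<phi> x) \<subseteq> carrier G" if "x \<in> ripsG k" "length x \<le> Suc m" for x
    using chain_map_on_keys[OF F(1) that] by (auto simp: chain_vertices_def rips_def)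
  obtain u where u: "0 < u"
    "\<And>x r v. x \<in> ripsG k \<Longrightarrow> length x \<le> Suc m \<Longrightarrow> x \<noteq> [] \<Longrightarrow> \<forall>w\<in>set x. r \<le> \<chi> w
      \<Longrightarrow> v \<in> chain_vertices (simplex_map \<phi> x) \<Longrightarrow> r + u \<le> \<chi> v"
    using \<chi> F(2) closed by (rule u_val_raises) (assumption | rule that)+
  have "\<exists>j\<ge>i. VR_homology_vanishes dist_w {g \<in> carrier G. 0 \<le> \<chi> g} q i j" if "q < m" for q i
    by (rule halfspace_homology_vanishes[OF _ _ _ F \<chi>(1) u that, of ks])
      (use assms(3,4) in \<open>auto simp: homological_connecting_vector_def\<close>)
  then show "\<chi> \<in> Sigma_inv G S m"
    using \<chi>(1) by (auto simp: Sigma_inv_def type_FP_def)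
qed

end
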